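(* Let $\mathbf d$ be any degree sequence and let $\mathcal H$ be either of the two stub-labeled directed hypergraph spaces $\mathcal H^{\mathrm{stub}}_{s,d,m}(\mathbf d)$ or $\mathcal H^{\mathrm{stub}}_{s,m}(\mathbf d)$. Then for $k\to\infty$ the double hyperarc shuffling method with $k$ steps on $\mathcal H$ samples uniformly from $\mathcal H$; that is, for every initial directed hypergraph $H_0\in\mathcal H$, the outcome $H_k$ of the method converges in distribution, as $k\to\infty$, to the uniform distribution on $\mathcal H$.
   Context: **Directed hypergraphs.** A directed hypergraph $H=(V,A)$ consists of a finite vertex set $V$ and a finite multiset $A=A(H)$ of hyperarcs; a hyperarc is a pair $a=(a^{\mathrm t},a^{\mathrm h})$ of multisets of elements of $V$ (its tail and head). $m_s(v)$ denotes the multiplicity of $v$ in a multiset $s$, and $\uplus$ is multiset union with multiplicities added. A hyperarc $a$ is a self-loop if $a^{\mathrm t}=a^{\mathrm h}$; it is degenerate if some vertex has multiplicity at least $2$ in $a^{\mathrm t}$ or in $a^{\mathrm h}$. Two hyperarcs $a_1,a_2$ of $H$ are multi-hyperarcs if $a_1^{\mathrm t}=a_2^{\mathrm t}$ and $a_1^{\mathrm h}=a_2^{\mathrm h}$. **Degrees.** $d_v^{\mathrm{in}}=\sum_{a\in A}m_{a^{\mathrm h}}(v)$, $d_v^{\mathrm{out}}=\sum_{a\in A}m_{a^{\mathrm t}}(v)$, $\delta_a^{\mathrm t}=|a^{\mathrm t}|$, $\delta_a^{\mathrm h}=|a^{\mathrm h}|$ (cardinalities with multiplicity). The degree sequence is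 $\mathbf d=(\mathbf d_V,\boldsymbol\delta_A)$ with $\mathbf d_V=((d_v^{\mathrm{in}},d_v^{\mathrm{out}}))_{v\in V}$ and $\boldsymbol\delta_A=((\delta_a^{\mathrm t},\delta_a^{\mathrm h}))_{a\in A}$ (the hyperarcs carry no names, so $\boldsymbol\delta_A$ is considered up to reordering). A degree sequence includes the vertex set $V$. **Stub-labeled hypergraphs.** Each vertex $v$ has $d_v^{\mathrm{out}}$ distinct out-stubs and $d_v^{\mathrm{in}}$ distinct in-stubs. In a stub-labeled directed hypergraph the tail (head) of every hyperarc is a set of out-stubs (in-stubs), every out-stub lies in exactly one tail and every in-stub in exactly one head; two stub-labeled directed hypergraphs are the same iff their collections of linked stubs are the same. Self-loops, degenerate hyperarcs and multi-hyperarcs are determined using only the underlying vertices (each stub replaced by its vertex). **Spaces.** For $x\subseteq\{s,d,m\}$, $\mathcal H^{\mathrm{stub}}_x(\mathbf d)$ is the set of all stub-labeled directed hypergraphs with degree sequence $\mathbf d$ that do not contain those of the features $s$ (self-loops), $d$ (degenerate hyperarcs), $m$ (multi-hyperarcs) that are not in $x$. Thus $\mathcal H^{\mathrm{stub}}_{s,d,m}(\mathbf d)$ has no restriction, and $\mathcal H^{\mathrm{stub}}_{s,m}(\mathbf d)$ forbids exactly degenerate hyperarcs. **Double hyperarc shuffle.** For two distinct hyperarcs $a,b$ of $H$ (distinct elements of the multiset $A(H)$), $S(a,b)$ is the set of pairs $(\hat a,\hat b)$ with $a^{\mathrm t}\uplus b^{\mathrm t}=\hat a^{\mathrm t}\uplus\hat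 b^{\mathrm t}$, $a^{\mathrm h}\uplus b^{\mathrm h}=\hat a^{\mathrm h}\uplus\hat b^{\mathrm h}$, $(\delta_a^{\mathrm t},\delta_a^{\mathrm h})=(\delta_{\hat a}^{\mathrm t},\delta_{\hat a}^{\mathrm h})$, $(\delta_b^{\mathrm t},\delta_b^{\mathrm h})=(\delta_{\hat b}^{\mathrm t},\delta_{\hat b}^{\mathrm h})$; for stub-labeled hypergraphs tails and heads here are sets of stubs. The shuffle $s(a,b|H)$ picks $(\hat a,\hat b)\in S(a,b)$ uniformly at random and outputs $H'$ with $A(H')=(A(H)\setminus\{a,b\})\uplus\{\hat a,\hat b\}$. **Double hyperarc shuffling method with $k$ steps** on a space $\mathcal H$, from $H_0\in\mathcal H$: for $i=0,1,\dots,k-1$, pick an unordered pair of distinct hyperarcs $a_i,b_i$ of $H_i$ uniformly at random, perform $s(a_i,b_i|H_i)$ (all choices independent), and let $H_{i+1}$ be the result if it lies in $\mathcal H$, and $H_{i+1}=H_i$ otherwise. The outcome is $H_k$. It is understood that there are at least two hyperarcs. *)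

theory Defs
  imports "HOL-Probability.Probability"
begin

section \<open>Directed hypergraphs\<close>

datatype 'v hyperarc = Hyperarc (tail: "'v multiset") (head: "'v multiset")

record 'v dihypergraph =
  verts :: "'v set"
  hyperarcs :: "'v hyperarc multiset"

definition dihypergraph :: "'v dihypergraph \<Rightarrow> bool" where
  "dihypergraph H \<longleftrightarrow> finite (verts H) \<and>
     (\<forall>a\<in>#hyperarcs H. set_mset (tail a) \<subseteq> verts H \<and> set_mset (head a) \<subseteq> verts H)"

definition self_loop :: "'v hyperarc \<Rightarrow> bool" where
  "self_loop a \<longleftrightarrow> tail a = head a"

definition degenerate :: "'v hyperarc \<Rightarrow> bool" where
  "degenerate a \<longleftrightarrow> (\<exists>v. count (tail a) v \<ge> 2 \<or> count (head a) v \<ge> 2)"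

datatype feature = Self_Loops | Degenerate_Hyperarcs | Multi_Hyperarcs

fun contains_feature :: "'v dihypergraph \<Rightarrow> feature \<Rightarrow> bool" where
  "contains_feature H Self_Loops \<longleftrightarrow> (\<exists>a\<in>#hyperarcs H. self_loop a)"
| "contains_feature H Degenerate_Hyperarcs \<longleftrightarrow> (\<exists>a\<in>#hyperarcs H. degenerate a)"
| "contains_feature H Multi_Hyperarcs \<longleftrightarrow> (\<exists>a. count (hyperarcs H) a \<ge> 2)"


section \<open>Degree sequences\<close>

definition in_degree :: "'v dihypergraph \<Rightarrow> 'v \<Rightarrow> nat" where
  "in_degree H v = (\<Sum>a\<in>#hyperarcs H. count (head a) v)"

definition out_degree :: "'v dihypergraph \<Rightarrow> 'v \<Rightarrow> nat" where
  "out_degree H v = (\<Sum>a\<in>#hyperarcs H. count (tail a) v)"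

definition arc_degree :: "'v hyperarc \<Rightarrow> nat \<times> nat" where
  "arc_degree a = (size (tail a), size (head a))"

text \<open>
  Hyperarcs carry no names, so their degrees form a multiset. The values of the
  two vertex degree functions outside the vertex set are irrelevant.
\<close>

record 'v degree_seq =
  seq_verts :: "'v set"
  seq_in :: "'v \<Rightarrow> nat"
  seq_out :: "'v \<Rightarrow> nat"
  seq_arcs :: "(nat \<times> nat) multiset"

definition has_degree_seq :: "'v dihypergraph \<Rightarrow> 'v degree_seq \<Rightarrow> bool" where
  "has_degree_seq H d \<longleftrightarrow>
     verts H = seq_verts d \<and>
     (\<forall>v\<in>seq_verts d. in_degree H v = seq_in d v \<and> out_degree H v = seq_out d v) \<and>
     image_mset arc_degree (hyperarcs H) = seq_arcs d"


section \<open>Stub-labeled directed hypergraphs\<close>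

datatype 'v stub = Out_Stub (vertex: 'v) nat | In_Stub (vertex: 'v) nat

definition out_stubs :: "'v degree_seq \<Rightarrow> 'v stub set" where
  "out_stubs d = {Out_Stub v i | v i. v \<in> seq_verts d \<and> i < seq_out d v}"

definition in_stubs :: "'v degree_seq \<Rightarrow> 'v stub set" where
  "in_stubs d = {In_Stub v i | v i. v \<in> seq_verts d \<and> i < seq_in d v}"

text \<open>
  A stub-labeled directed hypergraph is given by its collection of linked stubs.
  This is a multiset because a hyperarc with empty tail and empty head may occur
  repeatedly. Sets of stubs are represented as multisets without repetition, so
  that unlabeled and stub-labeled hyperarcs share one type.
\<close>

type_synonym 'v stub_graph = "'v stub hyperarc multiset"

definition no_repetition :: "'a multiset \<Rightarrow> bool" where
  "no_repetition M \<longleftrightarrow> (\<forall>x. count M x \<le> 1)"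

definition underlying :: "'v degree_seq \<Rightarrow> 'v stub_graph \<Rightarrow> 'v dihypergraph" where
  "underlying d H = \<lparr>verts = seq_verts d, hyperarcs = image_mset (map_hyperarc vertex) H\<rparr>"

definition stub_labeled :: "'v degree_seq \<Rightarrow> 'v stub_graph \<Rightarrow> bool" where
  "stub_labeled d H \<longleftrightarrow>
     (\<forall>a\<in>#H. no_repetition (tail a) \<and> set_mset (tail a) \<subseteq> out_stubs d \<and>
             no_repetition (head a) \<and> set_mset (head a) \<subseteq> in_stubs d) \<and>
     (\<forall>s\<in>out_stubs d. size {#a \<in># H. s \<in> set_mset (tail a)#} = 1) \<and>
     (\<forall>s\<in>in_stubs d. size {#a \<in># H. s \<in> set_mset (head a)#} = 1)"

definition stub_space :: "feature set \<Rightarrow> 'v degree_seq \<Rightarrow> 'v stub_graph set" where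
  "stub_space x d =
     {H. stub_labeled d H \<and> dihypergraph (underlying d H) \<and> has_degree_seq (underlying d H) d \<and>
         (\<forall>f. f \<notin> x \<longrightarrow> \<not> contains_feature (underlying d H) f)}"

lemma finite_multisets_bounded:
  assumes "finite S"
  shows "finite {M. set_mset M \<subseteq> S \<and> size M = n}"
proof -
  have "{M. set_mset M \<subseteq> S \<and> size M = n} \<subseteq> mset ` {xs. set xs \<subseteq> S \<and> length xs = n}"
  proof
    fix M assume M: "M \<in> {M. set_mset M \<subseteq> S \<and> size M = n}"
    obtain xs where "mset xs = M" using ex_mset by blast
    with M show "M \<in> mset ` {xs. set xs \<subseteq> S \<and> length xs = n}" by auto
  qed
  then show ?thesis
    using finite_lists_length_eq[OF assms] finite_surj by blast
qed

lemma finite_stub_space: "finite (stub_space x d)"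
proof (cases "finite (seq_verts d)")
  case False
  then have "stub_space x d = {}"
    by (auto simp: stub_space_def dihypergraph_def underlying_def)
  then show ?thesis by simp
next
  case True
  have out: "finite (out_stubs d)"
  proof -
    have "out_stubs d = (\<Union>v\<in>seq_verts d. Out_Stub v ` {..<seq_out d v})"
      by (auto simp: out_stubs_def)
    with True show ?thesis by simp
  qed
  have inn: "finite (in_stubs d)"
  proof -
    have "in_stubs d = (\<Union>v\<in>seq_verts d. In_Stub v ` {..<seq_in d v})"
      by (auto simp: in_stubs_def)
    with True show ?thesis by simp
  qed
  define T where "T = mset_set ` Pow (out_stubs d)"
  define U where "U = mset_set ` Pow (in_stubs d)"
  define B where "B = case_prod Hyperarc ` (T \<times> U)"
  have B: "finite B" using out inn by (simp add: B_def T_def U_def)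
  have eq: "M = mset_set (set_mset M)" if "no_repetition M" for M :: "'a stub multiset"
  proof (rule multiset_eqI)
    fix s
    have "count M s \<le> 1" using that by (simp add: no_repetition_def)
    then show "count M s = count (mset_set (set_mset M)) s"
      by (cases "s \<in># M") (auto simp: not_in_iff Suc_le_eq le_antisym)
  qed
  have "stub_space x d \<subseteq> {M. set_mset M \<subseteq> B \<and> size M = size (seq_arcs d)}"
  proof
    fix H assume H: "H \<in> stub_space x d"
    have "a \<in> B" if "a \<in># H" for a
    proof -
      have "no_repetition (tail a)" "set_mset (tail a) \<subseteq> out_stubs d"
        "no_repetition (head a)" "set_mset (head a) \<subseteq> in_stubs d"
        using H that by (auto simp: stub_space_def stub_labeled_def)
      then have "tail a \<in> T" "head a \<in> U"
        using eq[of "tail a"] eq[of "head a"] by (auto simp: T_def U_def)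
      then show ?thesis
        by (cases a) (force simp: B_def)
    qed
    moreover have "size H = size (seq_arcs d)"
      using H by (simp add: stub_space_def has_degree_seq_def underlying_def) (metis size_image_mset)
    ultimately show "H \<in> {M. set_mset M \<subseteq> B \<and> size M = size (seq_arcs d)}"
      by auto
  qed
  then show ?thesis
    using finite_multisets_bounded[OF B] finite_subset by blast
qed


section \<open>The double hyperarc shuffling method\<close>

definition shuffle_set :: "'a hyperarc \<Rightarrow> 'a hyperarc \<Rightarrow> ('a hyperarc \<times> 'a hyperarc) set" where
  "shuffle_set a b = {(a', b').
     tail a + tail b = tail a' + tail b' \<and>
     head a + head b = head a' + head b' \<and>
     arc_degree a = arc_degree a' \<and> arc_degree b = arc_degree b'}"

definition shuffle ::
  "'a hyperarc multiset \<Rightarrow> 'a hyperarc \<Rightarrow> 'a hyperarc \<Rightarrow> 'a hyperarc multiset pmf" where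
  "shuffle H a b =
     map_pmf (\<lambda>(a', b'). (H - {#a, b#}) + {#a', b'#}) (pmf_of_set (shuffle_set a b))"

lemma mem_shuffle_set: "(a, b) \<in> shuffle_set a b"
  by (simp add: shuffle_set_def)

lemma finite_shuffle_set: "finite (shuffle_set a b)"
proof -
  define T where "T = {M. M \<subseteq># tail a + tail b}"
  define U where "U = {M. M \<subseteq># head a + head b}"
  define B where "B = case_prod Hyperarc ` (T \<times> U)"
  have sub: "finite {M. M \<subseteq># N}" for N :: "'a multiset"
  proof (rule finite_subset)
    show "{M. M \<subseteq># N} \<subseteq> (\<Union>n\<le>size N. {M. set_mset M \<subseteq> set_mset N \<and> size M = n})"
      using set_mset_mono size_mset_mono by fastforce
  qed (simp add: finite_multisets_bounded)
  have "finite B" by (simp add: B_def T_def U_def sub)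
  moreover have "shuffle_set a b \<subseteq> B \<times> B"
  proof clarify
    fix a' b' assume "(a', b') \<in> shuffle_set a b"
    then have "tail a' \<in> T" "head a' \<in> U" "tail b' \<in> T" "head b' \<in> U"
      by (auto simp: shuffle_set_def T_def U_def)
    then show "a' \<in> B \<and> b' \<in> B"
      by (cases a'; cases b') (force simp: B_def)
  qed
  ultimately show ?thesis by (meson finite_SigmaI finite_subset)
qed

lemma shuffle_commute: "shuffle H a b = shuffle H b a"
proof -
  have swap: "shuffle_set b a = prod.swap ` shuffle_set a b"
    by (auto simp: shuffle_set_def image_iff ac_simps)
  have "pmf_of_set (shuffle_set b a) = map_pmf prod.swap (pmf_of_set (shuffle_set a b))"
    unfolding swap
    by (rule map_pmf_of_set_inj[symmetric])
      (use mem_shuffle_set[of a b] finite_shuffle_set in \<open>auto\<close>)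
  then show ?thesis
    by (simp add: shuffle_def map_pmf_comp case_prod_unfold add_mset_commute)
qed

text \<open>
  The distinct elements of a multiset: \<open>(a, i)\<close> is the \<open>i\<close>-th copy of \<open>a\<close>.
\<close>

definition instances :: "'a multiset \<Rightarrow> ('a \<times> nat) set" where
  "instances M = {(a, i). i < count M a}"

definition unordered_pairs :: "'a multiset \<Rightarrow> ('a \<times> nat) set set" where
  "unordered_pairs M = {P. P \<subseteq> instances M \<and> card P = 2}"

text \<open>
  By \<open>shuffle_commute\<close>, it is immaterial in which order the two elements
  of the chosen pair are passed to \<^const>\<open>shuffle\<close>.
\<close>

definition shuffle_pair ::
  "'a hyperarc multiset \<Rightarrow> ('a hyperarc \<times> nat) set \<Rightarrow> 'a hyperarc multiset pmf" where
  "shuffle_pair H P = (let (p, q) = (SOME (p, q). P = {p, q}) in shuffle H (fst p) (fst q))"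

lemma shuffle_pair_eq: "shuffle_pair H {p, q} = shuffle H (fst p) (fst q)"
proof -
  have "case (SOME (p', q'). {p, q} = {p', q'}) of (p', q') \<Rightarrow> {p, q} = {p', q'}"
    by (rule someI[where x = "(p, q)"]) simp
  then show ?thesis
    unfolding shuffle_pair_def Let_def
    by (auto simp: doubleton_eq_iff shuffle_commute split: prod.splits)
qed

definition shuffle_step ::
  "'a hyperarc multiset set \<Rightarrow> 'a hyperarc multiset \<Rightarrow> 'a hyperarc multiset pmf" where
  "shuffle_step \<H> H =
     bind_pmf (pmf_of_set (unordered_pairs H)) (\<lambda>P.
       map_pmf (\<lambda>H'. if H' \<in> \<H> then H' else H) (shuffle_pair H P))"

primrec shuffling_method ::
  "'a hyperarc multiset set \<Rightarrow> 'a hyperarc multiset \<Rightarrow> nat \<Rightarrow> 'a hyperarc multiset pmf" where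
  "shuffling_method \<H> H\<^sub>0 0 = return_pmf H\<^sub>0"
| "shuffling_method \<H> H\<^sub>0 (Suc k) = bind_pmf (shuffling_method \<H> H\<^sub>0 k) (shuffle_step \<H>)"


section \<open>Convergence in distribution\<close>

text \<open>
  Weak convergence of distributions on a discrete space, where every real function
  is continuous.
\<close>

definition converges_in_distribution :: "(nat \<Rightarrow> 'a pmf) \<Rightarrow> 'a pmf \<Rightarrow> bool" where
  "converges_in_distribution p q \<longleftrightarrow>
     (\<forall>f :: 'a \<Rightarrow> real. bounded (range f) \<longrightarrow>
        (\<lambda>k. measure_pmf.expectation (p k) f) \<longlonglongrightarrow> measure_pmf.expectation q f)"

end

theory Submission
  imports Defs
begin

text \<open>
  The method is a Markov chain on a finite space. Its kernel is symmetric, because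
  \<open>shuffle_set a b\<close> is unchanged if \<open>(a, b)\<close> is replaced by one of its elements; it is lazy,
  because \<open>(a, b) \<in> shuffle_set a b\<close>. If it is also irreducible, some power of the kernel
  has all entries positive and contracts the \<open>L\<^sup>1\<close>-distance to the uniform distribution.

  For irreducibility, number the hyperarcs of two members of the space so that their degrees agree,
  and transform first the tails, then the heads. The tails form a partition of the out-stubs into
  sets on which a labelling of the stubs is injective (by vertices if degenerate hyperarcs are
  forbidden, by the stubs themselves otherwise). Two such partitions with the same cardinalities are
  connected by exchanges between two parts: by a Havel-Hakimi argument one part
  can be brought to consist of stubs with the most frequent labels, and the remaining parts are
  treated by induction.
\<close>

section \<open>Symmetric Markov kernels\<close>

primrec kernel_power :: "'a set \<Rightarrow> ('a \<Rightarrow> 'a \<Rightarrow> real) \<Rightarrow> nat \<Rightarrow> 'a \<Rightarrow> 'a \<Rightarrow> real" where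
  "kernel_power X K 0 x y = (if x = y then 1 else 0)"
| "kernel_power X K (Suc n) x y = (\<Sum>z\<in>X. kernel_power X K n x z * K z y)"

lemma kernel_power_nonneg:
  assumes "\<And>x y. x \<in> X \<Longrightarrow> y \<in> X \<Longrightarrow> 0 \<le> K x y" "x \<in> X" "y \<in> X"
  shows "0 \<le> kernel_power X K n x y"
  using assms(3) by (induction n arbitrary: y) (auto intro!: sum_nonneg mult_nonneg_nonneg assms)

lemma kernel_power_row_sum:
  assumes "finite X" "\<And>x. x \<in> X \<Longrightarrow> (\<Sum>y\<in>X. K x y) = 1" "x \<in> X"
  shows "(\<Sum>y\<in>X. kernel_power X K n x y) = 1"
proof (induction n)
  case 0
  then show ?case using assms by simp
next
  case (Suc n)
  have "(\<Sum>y\<in>X. kernel_power X K (Suc n) x y) = (\<Sum>z\<in>X. \<Sum>y\<in>X. kernel_power X K n x z * K z y)"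
    by (simp, rule sum.swap)
  also have "\<dots> = (\<Sum>z\<in>X. kernel_power X K n x z)"
    using assms(2) by (simp flip: sum_distrib_left)
  finally show ?case using Suc by simp
qed

lemma kernel_power_pos_Suc:
  assumes "finite X" and nonneg: "\<And>x y. x \<in> X \<Longrightarrow> y \<in> X \<Longrightarrow> 0 \<le> K x y"
    and "x \<in> X" "y \<in> X" "z \<in> X" "0 < kernel_power X K n x y" "0 < K y z"
  shows "0 < kernel_power X K (Suc n) x z"
proof -
  have "0 < kernel_power X K n x y * K y z" using assms by simp
  also have "\<dots> \<le> (\<Sum>w\<in>X. kernel_power X K n x w * K w z)"
    using assms by (intro member_le_sum) (auto intro!: mult_nonneg_nonneg kernel_power_nonneg)
  finally show ?thesis by simp
qed

text \<open>A positive diagonal keeps a positive entry positive in all higher powers, so the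
  exponents found for the individual pairs can all be raised to their maximum.\<close>

lemma kernel_power_eventually_pos:
  assumes "finite X" and nonneg: "\<And>x y. x \<in> X \<Longrightarrow> y \<in> X \<Longrightarrow> 0 \<le> K x y"
    and diag: "\<And>x. x \<in> X \<Longrightarrow> 0 < K x x"
    and irred: "\<And>x y. x \<in> X \<Longrightarrow> y \<in> X \<Longrightarrow> (x, y) \<in> {(x, y). x \<in> X \<and> y \<in> X \<and> 0 < K x y}\<^sup>*"
  shows "\<exists>N. \<forall>x\<in>X. \<forall>y\<in>X. 0 < kernel_power X K N x y"
proof -
  have mono: "0 < kernel_power X K n x y" if "x \<in> X" "y \<in> X" "0 < kernel_power X K m x y" "m \<le> n" for x y m n
    using that(4,3)
  proof (induction n rule: dec_induct)
    case (step n)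
    then show ?case using kernel_power_pos_Suc[of X K x y y n] assms(1) nonneg diag that(1,2) by blast
  qed
  have "\<exists>n. 0 < kernel_power X K n x y" if "x \<in> X" "y \<in> X" for x y
    using irred[OF that]
  proof (induction rule: rtrancl_induct)
    case base
    have "0 < kernel_power X K 0 x x" by simp
    then show ?case by blast
  next
    case (step y z)
    then obtain n where "0 < kernel_power X K n x y" "y \<in> X" "z \<in> X" "0 < K y z" by blast
    then have "0 < kernel_power X K (Suc n) x z"
      using kernel_power_pos_Suc[of X K x y z n] assms(1) nonneg that(1) by blast
    then show ?case by blast
  qed
  then obtain n where n: "\<And>x y. x \<in> X \<Longrightarrow> y \<in> X \<Longrightarrow> 0 < kernel_power X K (n x y) x y"
    by metis
  define N where "N = Max ((\<lambda>(x, y). n x y) ` (X \<times> X))"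
  have "n x y \<le> N" if "x \<in> X" "y \<in> X" for x y
    unfolding N_def using assms(1) that by (intro Max_ge) auto
  then show ?thesis using mono n by blast
qed

text \<open>Symmetry makes the columns sum to 1, so the uniform distribution is stationary and the
  deviation \<open>q\<close> evolves under the same kernel. Its norm \<open>D\<close> never
  increases, hence converges, and the contraction over \<open>N\<close> steps leaves 0 as the only
  possible limit.\<close>

lemma iterated_kernel_tendsto_uniform:
  fixes K :: "'a \<Rightarrow> 'a \<Rightarrow> real" and p :: "nat \<Rightarrow> 'a \<Rightarrow> real"
  assumes fin: "finite X"
    and nonneg: "\<And>x y. x \<in> X \<Longrightarrow> y \<in> X \<Longrightarrow> 0 \<le> K x y"
    and rows: "\<And>x. x \<in> X \<Longrightarrow> (\<Sum>y\<in>X. K x y) = 1"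
    and sym: "\<And>x y. x \<in> X \<Longrightarrow> y \<in> X \<Longrightarrow> K x y = K y x"
    and diag: "\<And>x. x \<in> X \<Longrightarrow> 0 < K x x"
    and irred: "\<And>x y. x \<in> X \<Longrightarrow> y \<in> X \<Longrightarrow> (x, y) \<in> {(x, y). x \<in> X \<and> y \<in> X \<and> 0 < K x y}\<^sup>*"
    and total: "\<And>k. (\<Sum>x\<in>X. p k x) = 1"
    and step: "\<And>k y. y \<in> X \<Longrightarrow> p (Suc k) y = (\<Sum>x\<in>X. p k x * K x y)"
    and y: "y \<in> X"
  shows "(\<lambda>k. p k y) \<longlonglongrightarrow> 1 / card X"
proof -
  define q where "q k x = p k x - 1 / card X" for k x
  have cX: "card X > 0" using fin y card_gt_0_iff by blast
  have q_sum: "(\<Sum>x\<in>X. q k x) = 0" for k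
    using total[of k] cX by (simp add: q_def sum_subtractf)
  have cols: "(\<Sum>x\<in>X. K x z) = 1" if "z \<in> X" for z
    using rows[OF that] sym[OF that] by (metis (mono_tags, lifting) sum.cong)
  have q_step: "q (Suc k) z = (\<Sum>x\<in>X. q k x * K x z)" if "z \<in> X" for k z
    using step[OF that, of k] cols[OF that]
    by (simp add: q_def left_diff_distrib sum_subtractf flip: sum_divide_distrib)
  have q_steps: "q (k + n) z = (\<Sum>x\<in>X. q k x * kernel_power X K n x z)" if "z \<in> X" for k n z
    using that
  proof (induction n arbitrary: z)
    case 0
    then show ?case using fin by (simp add: if_distrib cong: if_cong)
  next
    case (Suc n)
    have "q (k + Suc n) z = (\<Sum>w\<in>X. \<Sum>x\<in>X. q k x * kernel_power X K n x w * K w z)"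
      using Suc q_step[of z "k + n"] by (simp add: sum_distrib_right)
    also have "\<dots> = (\<Sum>x\<in>X. \<Sum>w\<in>X. q k x * kernel_power X K n x w * K w z)"
      by (rule sum.swap)
    finally show ?case by (simp add: sum_distrib_left mult.assoc)
  qed
  define D where "D k = (\<Sum>x\<in>X. \<bar>q k x\<bar>)" for k
  \<comment> \<open>\<open>q k\<close> sums to zero, so a constant may be subtracted from the kernel.\<close>
  have contract: "D (k + n) \<le> (1 - card X * e) * D k"
    if e: "\<And>x z. x \<in> X \<Longrightarrow> z \<in> X \<Longrightarrow> e \<le> kernel_power X K n x z" for k n and e :: real
  proof -
    have "\<bar>q (k + n) z\<bar> \<le> (\<Sum>x\<in>X. \<bar>q k x\<bar> * (kernel_power X K n x z - e))" if "z \<in> X" for z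
    proof -
      have "q (k + n) z = (\<Sum>x\<in>X. q k x * (kernel_power X K n x z - e))"
        using q_steps[OF that, of k n] q_sum[of k]
        by (simp add: right_diff_distrib sum_subtractf flip: sum_distrib_right)
      then show ?thesis
        using e that sum_abs[of "\<lambda>x. q k x * (kernel_power X K n x z - e)" X]
        by (simp add: abs_mult)
    qed
    then have "D (k + n) \<le> (\<Sum>z\<in>X. \<Sum>x\<in>X. \<bar>q k x\<bar> * (kernel_power X K n x z - e))"
      unfolding D_def by (intro sum_mono)
    also have "\<dots> = (\<Sum>x\<in>X. \<Sum>z\<in>X. \<bar>q k x\<bar> * (kernel_power X K n x z - e))"
      by (rule sum.swap)
    also have "\<dots> = (\<Sum>x\<in>X. \<bar>q k x\<bar> * (1 - card X * e))"
      using kernel_power_row_sum[of X K, OF fin rows]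
      by (simp add: sum_subtractf flip: sum_distrib_left)
    finally show ?thesis by (simp add: D_def mult.commute flip: sum_distrib_right)
  qed
  \<comment> \<open>This is the contraction estimate for a single step with the trivial bound
    \<open>e = 0\<close>.\<close>
  have "D (Suc k) \<le> D k" for k
  proof -
    have "0 \<le> kernel_power X K 1 x z" if "x \<in> X" "z \<in> X" for x z
      using nonneg that by (rule kernel_power_nonneg)
    then show ?thesis using contract[of 0 1 k] by simp
  qed
  then have dec: "decseq D" by (rule decseq_SucI)
  moreover have D0: "0 \<le> D k" for k by (simp add: D_def sum_nonneg)
  ultimately obtain L where L: "D \<longlonglongrightarrow> L" using decseq_convergent[of D 0] by blast
  obtain N where N: "\<forall>x\<in>X. \<forall>y\<in>X. 0 < kernel_power X K N x y"
    using kernel_power_eventually_pos[of X K, OF fin nonneg diag irred] by blast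
  define e where "e = Min ((\<lambda>(x, z). kernel_power X K N x z) ` (X \<times> X))"
  have e: "e \<le> kernel_power X K N x z" if "x \<in> X" "z \<in> X" for x z
    unfolding e_def using fin that by (intro Min_le) auto
  have "0 < e" unfolding e_def using N y fin by (subst Min_gr_iff) auto
  have "(\<lambda>k. D (k + N)) \<longlonglongrightarrow> L" by (rule LIMSEQ_ignore_initial_segment[OF L])
  moreover have "(\<lambda>k. (1 - card X * e) * D k) \<longlonglongrightarrow> (1 - card X * e) * L"
    by (intro tendsto_intros L)
  \<comment> \<open>The contraction over \<open>N\<close> steps passes to the limit; as
    \<open>card X * e\<close> is positive, \<open>L\<close> cannot be.\<close>
  ultimately have "L \<le> (1 - card X * e) * L"
    using contract[OF e] by (intro LIMSEQ_le) auto
  then have "card X * e * L \<le> 0" by (simp add: algebra_simps)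
  moreover have "0 < card X * e" using cX \<open>0 < e\<close> by simp
  ultimately have "L \<le> 0" using mult_pos_pos not_le by blast
  moreover have "0 \<le> L" using D0 L by (intro LIMSEQ_le_const) auto
  ultimately have "D \<longlonglongrightarrow> 0" using L by simp
  moreover have "\<bar>q k y\<bar> \<le> D k" for k
    unfolding D_def using fin y by (intro member_le_sum) auto
  ultimately have "(\<lambda>k. q k y) \<longlonglongrightarrow> 0"
    by (intro Lim_null_comparison[of "\<lambda>k. q k y" D]) auto
  then show ?thesis using LIM_zero_iff unfolding q_def by blast
qed


section \<open>Exchanges in labelled partitions\<close>

text \<open>The parts model the tails (or the heads) of numbered hyperarcs. An indexed family is
  used because several parts may be empty.\<close>

definition labeled_partition :: "('s \<Rightarrow> 'l) \<Rightarrow> 'i set \<Rightarrow> 's set \<Rightarrow> ('i \<Rightarrow> 's set) \<Rightarrow> bool" where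
  "labeled_partition \<phi> I S T \<longleftrightarrow>
     (\<forall>i\<in>I. inj_on \<phi> (T i)) \<and> disjoint_family_on T I \<and> (\<Union>i\<in>I. T i) = S"

text \<open>Any number of elements may be redistributed between two parts, as in a shuffle. The
  identity is included, so that tails can move while heads rest. Imposing injectivity before and
  after makes the relation symmetric.\<close>

definition exchange_at ::
  "('s \<Rightarrow> 'l) \<Rightarrow> 'i \<Rightarrow> 'i \<Rightarrow> ('i \<Rightarrow> 's set) \<Rightarrow> ('i \<Rightarrow> 's set) \<Rightarrow> bool" where
  "exchange_at \<phi> i j T T' \<longleftrightarrow> i \<noteq> j \<and> (\<forall>k. k \<noteq> i \<longrightarrow> k \<noteq> j \<longrightarrow> T' k = T k) \<and>
     T' i \<union> T' j = T i \<union> T j \<and> T i \<inter> T j = {} \<and> T' i \<inter> T' j = {} \<and> finite (T i \<union> T j) \<and>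
     card (T' i) = card (T i) \<and> card (T' j) = card (T j) \<and>
     inj_on \<phi> (T i) \<and> inj_on \<phi> (T j) \<and> inj_on \<phi> (T' i) \<and> inj_on \<phi> (T' j)"

definition exchange :: "('s \<Rightarrow> 'l) \<Rightarrow> 'i set \<Rightarrow> (('i \<Rightarrow> 's set) \<times> ('i \<Rightarrow> 's set)) set" where
  "exchange \<phi> I = {(T, T'). \<exists>i\<in>I. \<exists>j\<in>I. exchange_at \<phi> i j T T'}"

lemma exchange_at_sym:
  assumes "exchange_at \<phi> i j T T'"
  shows "exchange_at \<phi> i j T' T"
proof -
  have eq: "T' i \<union> T' j = T i \<union> T j" and k: "\<forall>k. k \<noteq> i \<longrightarrow> k \<noteq> j \<longrightarrow> T' k = T k"
    and rest: "i \<noteq> j" "T i \<inter> T j = {}" "T' i \<inter> T' j = {}" "finite (T i \<union> T j)"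
      "card (T' i) = card (T i)" "card (T' j) = card (T j)"
      "inj_on \<phi> (T i)" "inj_on \<phi> (T j)" "inj_on \<phi> (T' i)" "inj_on \<phi> (T' j)"
    using assms unfolding exchange_at_def by simp_all
  have "\<forall>k. k \<noteq> i \<longrightarrow> k \<noteq> j \<longrightarrow> T k = T' k" using k by simp
  moreover have "finite (T' i \<union> T' j)" using rest(4) unfolding eq .
  ultimately show ?thesis
    using rest eq[symmetric] rest(5,6)[symmetric] unfolding exchange_at_def
    by (intro conjI) assumption+
qed

lemma exchangeE:
  assumes "(T, T') \<in> exchange \<phi> I"
  obtains i j where "i \<in> I" "j \<in> I" "exchange_at \<phi> i j T T'"
  using assms unfolding exchange_def by auto

lemma exchangeI: "i \<in> I \<Longrightarrow> j \<in> I \<Longrightarrow> exchange_at \<phi> i j T T' \<Longrightarrow> (T, T') \<in> exchange \<phi> I"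
  unfolding exchange_def by auto

lemma exchange_sym: "(T, T') \<in> exchange \<phi> I \<Longrightarrow> (T', T) \<in> exchange \<phi> I"
  by (erule exchangeE) (rule exchangeI, assumption, assumption, rule exchange_at_sym)

lemma exchange_mono: "I \<subseteq> J \<Longrightarrow> exchange \<phi> I \<subseteq> exchange \<phi> J"
  by (auto elim!: exchangeE intro: exchangeI)

lemma exchange_card:
  assumes "(T, T') \<in> exchange \<phi> I"
  shows "card (T' k) = card (T k)"
  using assms
proof (rule exchangeE)
  fix i j assume "exchange_at \<phi> i j T T'"
  then have "\<forall>k. k \<noteq> i \<longrightarrow> k \<noteq> j \<longrightarrow> T' k = T k" "card (T' i) = card (T i)" "card (T' j) = card (T j)"
    unfolding exchange_at_def by blast+
  then show ?thesis by metis
qed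

lemma exchange_outside:
  assumes "(T, T') \<in> exchange \<phi> I" "k \<notin> I"
  shows "T' k = T k"
proof -
  obtain i j where "i \<in> I" "j \<in> I" "exchange_at \<phi> i j T T'"
    using assms(1) by (rule exchangeE)
  then show ?thesis using assms(2) unfolding exchange_at_def by metis
qed

lemma exchange_partition:
  assumes "(T, T') \<in> exchange \<phi> I" "labeled_partition \<phi> I S T"
  shows "labeled_partition \<phi> I S T'"
proof -
  obtain i j where ij: "i \<in> I" "j \<in> I" "i \<noteq> j" "\<And>k. k \<noteq> i \<Longrightarrow> k \<noteq> j \<Longrightarrow> T' k = T k"
    "T' i \<union> T' j = T i \<union> T j" "T' i \<inter> T' j = {}" "inj_on \<phi> (T' i)" "inj_on \<phi> (T' j)"
    using assms(1) unfolding exchange_def exchange_at_def by auto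
  have T: "\<forall>i\<in>I. inj_on \<phi> (T i)" "disjoint_family_on T I" "(\<Union>i\<in>I. T i) = S"
    using assms(2) by (auto simp: labeled_partition_def)
  have "inj_on \<phi> (T' k)" if "k \<in> I" for k
    using that ij T(1) by (cases "k = i"; cases "k = j") auto
  moreover have "disjoint_family_on T' I"
    unfolding disjoint_family_on_def
  proof (intro ballI impI)
    fix k l assume kl: "k \<in> I" "l \<in> I" "k \<noteq> l"
    have d: "T k \<inter> T l = {}" if "k \<in> I" "l \<in> I" "k \<noteq> l" for k l
      using T(2) that unfolding disjoint_family_on_def by blast
    have o: "T k \<inter> T' i = {} \<and> T k \<inter> T' j = {}" if "k \<in> I" "k \<noteq> i" "k \<noteq> j" for k
      using d[OF that(1) ij(1) that(2)] d[OF that(1) ij(2) that(3)] ij(5) by blast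
    show "T' k \<inter> T' l = {}"
      using kl ij(4)[of k] ij(4)[of l] ij(6) d[OF kl] o[of k] o[of l]
      by (cases "k = i"; cases "k = j"; cases "l = i"; cases "l = j") auto
  qed
  moreover have "(\<Union>k\<in>I. T' k) = S"
  proof -
    have "(\<Union>k\<in>I. T' k) = (\<Union>k\<in>I - {i, j}. T' k) \<union> (T' i \<union> T' j)" using ij(1,2) by blast
    also have "\<dots> = (\<Union>k\<in>I - {i, j}. T k) \<union> (T i \<union> T j)" using ij(4,5) by simp
    also have "\<dots> = S" unfolding T(3)[symmetric] using ij(1,2) by blast
    finally show ?thesis .
  qed
  ultimately show ?thesis by (simp add: labeled_partition_def)
qed

text \<open>The smallest exchange, one element for one. The conditions \<open>inj\<close> compare an
  incoming label only with the labels that stay, so swapping equal labels is covered.\<close>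

lemma exchange_swap:
  assumes T: "labeled_partition \<phi> I S T" "finite S"
    and ij: "i \<in> I" "j \<in> I" "i \<noteq> j" "s \<in> T i" "t \<in> T j"
    and inj: "\<phi> t \<notin> \<phi> ` (T i - {s})" "\<phi> s \<notin> \<phi> ` (T j - {t})"
  shows "(T, T(i := insert t (T i - {s}), j := insert s (T j - {t}))) \<in> exchange \<phi> I"
proof -
  have disj: "T i \<inter> T j = {}"
    using T(1) ij unfolding labeled_partition_def disjoint_family_on_def by blast
  have fin: "finite (T i)" "finite (T j)"
    using T ij unfolding labeled_partition_def by (auto intro: finite_subset)
  have st: "s \<notin> T j" "t \<notin> T i" using disj ij by auto
  have inj_T: "inj_on \<phi> (T i)" "inj_on \<phi> (T j)"
    using T(1) ij unfolding labeled_partition_def by auto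
  have c: "card (insert t (T i - {s})) = card (T i)" "card (insert s (T j - {t})) = card (T j)"
    using fin st ij by (auto simp: card.insert_remove card_Suc_Diff1 simp del: card_Diff_insert)
  have "inj_on \<phi> (insert t (T i - {s}))" "inj_on \<phi> (insert s (T j - {t}))"
    using inj inj_T by (auto simp: inj_on_insert intro: inj_on_subset)
  then show ?thesis
    unfolding exchange_def exchange_at_def mem_Collect_eq case_prod_conv
    using ij disj fin st inj_T c
    by (intro bexI[of _ i] bexI[of _ j]) auto
qed

text \<open>Each part contains a label at most once. Hence the number of parts showing a label is
  fixed by \<open>S\<close> and \<open>\<phi>\<close>, and frequencies in \<open>S\<close> can be
  compared inside any partition.\<close>

lemma card_label_eq:
  assumes "labeled_partition \<phi> I S T" "finite I" "finite S"
  shows "card {s \<in> S. \<phi> s = v} = card {i \<in> I. v \<in> \<phi> ` T i}"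
proof -
  have inj: "\<And>i. i \<in> I \<Longrightarrow> inj_on \<phi> (T i)" and S: "(\<Union>i\<in>I. T i) = S"
    and dis: "disjoint_family_on T I"
    using assms(1) by (auto simp: labeled_partition_def)
  have "{s \<in> S. \<phi> s = v} = (\<Union>i\<in>I. {s \<in> T i. \<phi> s = v})" using S by blast
  then have "card {s \<in> S. \<phi> s = v} = (\<Sum>i\<in>I. card {s \<in> T i. \<phi> s = v})"
    using dis assms(2,3) S
    by (simp, subst card_UN_disjoint) (auto simp: disjoint_family_on_def intro: finite_subset)
  also have "\<dots> = (\<Sum>i\<in>I. of_bool (v \<in> \<phi> ` T i))"
  proof (intro sum.cong refl)
    fix i assume "i \<in> I"
    show "card {s \<in> T i. \<phi> s = v} = of_bool (v \<in> \<phi> ` T i)"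
    proof (cases "v \<in> \<phi> ` T i")
      case True
      then obtain s where "s \<in> T i" "\<phi> s = v" by blast
      then have "{s \<in> T i. \<phi> s = v} = {s}" using inj[OF \<open>i \<in> I\<close>] by (auto dest: inj_onD)
      then show ?thesis using True by simp
    next
      case False
      then have "{s \<in> T i. \<phi> s = v} = {}" by blast
      then show ?thesis using False by (simp only: card.empty) simp
    qed
  qed
  also have "\<dots> = card {i \<in> I. v \<in> \<phi> ` T i}"
    using assms(2) by (simp add: sum.inter_filter Int_def flip: card_eq_sum)
  finally show ?thesis .
qed

lemma ex_mem_Diff_if_card_le:
  assumes "finite A" "card A \<le> card B" "x \<in> A - B"
  shows "\<exists>y. y \<in> B - A"
proof (rule ccontr)
  assume "\<nexists>y. y \<in> B - A"
  then have "B \<subset> A" using assms(3) by blast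
  from psubset_card_mono[OF assms(1) this] show False using assms(2) by simp
qed

text \<open>
  The measure adds two overlaps, because the element that gains a label of \<open>C\<close> for \<open>T i\<close>
  need not lie in \<open>C\<close>; it is traded for the right one by a later exchange of equal labels.
  If a label of \<open>C\<close> is missing from \<open>T i\<close>, counting occurrences yields an index \<open>j\<close> that
  has this label but lacks a superfluous label of \<open>T i\<close>.
\<close>

lemma exchange_towards:
  assumes T: "labeled_partition \<phi> I S T" and fin: "finite I" "finite S" and i: "i \<in> I"
    and C: "C \<subseteq> S" "inj_on \<phi> C" "card (T i) = card C" "T i \<noteq> C"
    and top: "\<And>c s. c \<in> C \<Longrightarrow> s \<in> S \<Longrightarrow> \<phi> s \<notin> \<phi> ` C \<Longrightarrow>
      card {x \<in> S. \<phi> x = \<phi> s} \<le> card {x \<in> S. \<phi> x = \<phi> c}"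
  shows "\<exists>T'. (T, T') \<in> exchange \<phi> I \<and>
    card (\<phi> ` T i \<inter> \<phi> ` C) + card (T i \<inter> C) < card (\<phi> ` T' i \<inter> \<phi> ` C) + card (T' i \<inter> C)"
proof -
  have inj: "\<And>i. i \<in> I \<Longrightarrow> inj_on \<phi> (T i)" and S: "(\<Union>i\<in>I. T i) = S"
    and dis: "\<And>i j. i \<in> I \<Longrightarrow> j \<in> I \<Longrightarrow> i \<noteq> j \<Longrightarrow> T i \<inter> T j = {}"
    using T by (auto simp: labeled_partition_def disjoint_family_on_def)
  have finT: "finite (T i)" if "i \<in> I" for i using that S fin(2) by (auto intro: finite_subset)
  have finC: "finite C" using C(1) fin(2) finite_subset by blast
  show ?thesis
  proof (cases "\<exists>t\<in>C - T i. \<phi> t \<in> \<phi> ` T i")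
    case True
    then obtain s t where st: "t \<in> C" "t \<notin> T i" "s \<in> T i" "\<phi> t = \<phi> s" by blast
    then have sC: "s \<notin> C" using C(2) by (auto dest: inj_onD)
    obtain j where j: "j \<in> I" "t \<in> T j" using st(1) C(1) S by blast
    then have ji: "i \<noteq> j" using st by blast
    have n: "\<phi> t \<notin> \<phi> ` (T i - {s})" "\<phi> s \<notin> \<phi> ` (T j - {t})"
      using inj[OF i] inj[OF j(1)] st j by (auto dest: inj_onD)
    let ?T = "T(i := insert t (T i - {s}), j := insert s (T j - {t}))"
    have "(T, ?T) \<in> exchange \<phi> I"
      by (rule exchange_swap[OF T fin(2) i j(1) ji st(3) j(2) n])
    moreover have "\<phi> ` ?T i = \<phi> ` T i" using st ji by auto
    moreover have "card (T i \<inter> C) < card (?T i \<inter> C)"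
      using st sC ji finC by (intro psubset_card_mono) auto
    ultimately show ?thesis by (intro exI[of _ ?T]) simp
  next
    case False
    obtain t where t: "t \<in> C" "t \<notin> T i" using C(3,4) card_subset_eq[OF finT[OF i], of C] by auto
    obtain s where s: "s \<in> T i" "s \<notin> C" using C(3,4) card_subset_eq[OF finC, of "T i"] by auto
    have tT: "\<phi> t \<notin> \<phi> ` T i" using False t by blast
    \<comment> \<open>An element of \<open>C\<close> with the label of \<open>s\<close> would lie
      outside \<open>T i\<close> by injectivity, and the first case would apply.\<close>
    have sC: "\<phi> s \<notin> \<phi> ` C"
    proof
      assume "\<phi> s \<in> \<phi> ` C"
      then obtain c where c: "c \<in> C" "\<phi> c = \<phi> s" by auto
      then have "c \<notin> T i" using inj[OF i] s by (auto dest: inj_onD)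
      then show False using False c s(1) by (metis DiffI imageI)
    qed
    have "card {k \<in> I. \<phi> s \<in> \<phi> ` T k} \<le> card {k \<in> I. \<phi> t \<in> \<phi> ` T k}"
      using top[OF t(1) _ sC] s i S card_label_eq[OF T fin] by auto
    moreover have "i \<in> {k \<in> I. \<phi> s \<in> \<phi> ` T k} - {k \<in> I. \<phi> t \<in> \<phi> ` T k}"
      using i s tT by simp
    moreover have "finite {k \<in> I. \<phi> s \<in> \<phi> ` T k}" using fin(1) by simp
    ultimately obtain j where "j \<in> {k \<in> I. \<phi> t \<in> \<phi> ` T k} - {k \<in> I. \<phi> s \<in> \<phi> ` T k}"
      using ex_mem_Diff_if_card_le by metis
    then have j: "j \<in> I" "\<phi> t \<in> \<phi> ` T j" "\<phi> s \<notin> \<phi> ` T j" by blast+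
    then have ji: "i \<noteq> j" using tT by blast
    obtain t' where t': "t' \<in> T j" "\<phi> t' = \<phi> t" using j(2) by auto
    have n: "\<phi> t' \<notin> \<phi> ` (T i - {s})" "\<phi> s \<notin> \<phi> ` (T j - {t'})"
      using tT j(3) t'(2) by auto
    let ?T = "T(i := insert t' (T i - {s}), j := insert s (T j - {t'}))"
    have "(T, ?T) \<in> exchange \<phi> I"
      by (rule exchange_swap[OF T fin(2) i j(1) ji s(1) t'(1) n])
    moreover have "card (\<phi> ` T i \<inter> \<phi> ` C) < card (\<phi> ` ?T i \<inter> \<phi> ` C)"
    proof (rule psubset_card_mono)
      show "finite (\<phi> ` ?T i \<inter> \<phi> ` C)" using finC by blast
      have "\<phi> ` T i \<inter> \<phi> ` C \<subseteq> \<phi> ` ?T i \<inter> \<phi> ` C" using sC ji by auto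
      moreover have "\<phi> t \<in> \<phi> ` ?T i \<inter> \<phi> ` C" 
        using imageI[OF t(1), of \<phi>] imageI[of t' "?T i" \<phi>] t'(2) ji by simp
      ultimately show "\<phi> ` T i \<inter> \<phi> ` C \<subset> \<phi> ` ?T i \<inter> \<phi> ` C" using tT by blast
    qed
    \<comment> \<open>The element \<open>s\<close> that leaves \<open>T i\<close> is not in
      \<open>C\<close>, so the second overlap does not shrink while the first one grows.\<close>
    moreover have "card (T i \<inter> C) \<le> card (?T i \<inter> C)"
      using s ji finC by (intro card_mono) auto
    ultimately show ?thesis by (intro exI[of _ ?T]) linarith
  qed
qed

text \<open>Both overlaps are bounded by \<open>card C\<close>, so the measure that
  \<open>exchange_towards\<close> increases can grow only finitely often. Exchanges preserve the
  partition property and the cardinalities.\<close>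

lemma exchange_reach_row:
  assumes fin: "finite I" "finite S" and i: "i \<in> I"
    and C: "C \<subseteq> S" "inj_on \<phi> C"
    and top: "\<And>c s. c \<in> C \<Longrightarrow> s \<in> S \<Longrightarrow> \<phi> s \<notin> \<phi> ` C \<Longrightarrow>
      card {x \<in> S. \<phi> x = \<phi> s} \<le> card {x \<in> S. \<phi> x = \<phi> c}"
    and T: "labeled_partition \<phi> I S T" "card (T i) = card C"
  shows "\<exists>T'. (T, T') \<in> (exchange \<phi> I)\<^sup>* \<and> T' i = C"
  using T
proof (induction "2 * card C - (card (\<phi> ` T i \<inter> \<phi> ` C) + card (T i \<inter> C))"
    arbitrary: T rule: less_induct)
  case less
  show ?case
  proof (cases "T i = C")
    case False
    have finC: "finite C" using C(1) fin(2) finite_subset by blast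
    obtain T1 where T1: "(T, T1) \<in> exchange \<phi> I"
      "card (\<phi> ` T i \<inter> \<phi> ` C) + card (T i \<inter> C) < card (\<phi> ` T1 i \<inter> \<phi> ` C) + card (T1 i \<inter> C)"
      using exchange_towards[OF less(2) fin i C less(3) False top] by blast
    have "card (\<phi> ` T1 i \<inter> \<phi> ` C) \<le> card C"
      using card_mono[of "\<phi> ` C" "\<phi> ` T1 i \<inter> \<phi> ` C"] card_image_le[OF finC, of \<phi>] finC by auto
    moreover have "card (T1 i \<inter> C) \<le> card C" using finC by (intro card_mono) auto
    ultimately have "\<exists>T'. (T1, T') \<in> (exchange \<phi> I)\<^sup>* \<and> T' i = C"
      using T1(2) exchange_partition[OF T1(1) less(2)] exchange_card[OF T1(1), of i] less(3)
      by (intro less(1)) auto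
    then show ?thesis using converse_rtrancl_into_rtrancl[OF T1(1)] by blast
  qed auto
qed

lemma ex_top_transversal:
  assumes fin: "finite S" and T: "T \<subseteq> S" "inj_on \<phi> T"
  shows "\<exists>C\<subseteq>S. inj_on \<phi> C \<and> card C = card T \<and>
    (\<forall>c\<in>C. \<forall>s\<in>S. \<phi> s \<notin> \<phi> ` C \<longrightarrow> card {x \<in> S. \<phi> x = \<phi> s} \<le> card {x \<in> S. \<phi> x = \<phi> c})"
proof -
  define w where "w s = card {x \<in> S. \<phi> x = \<phi> s}" for s
  define F where "F = {C. C \<subseteq> S \<and> inj_on \<phi> C \<and> card C = card T}"
  have "finite F" "F \<noteq> {}" using assms by (auto simp: F_def)
  then obtain C where C: "C \<in> F" and max: "\<And>C'. C' \<in> F \<Longrightarrow> sum w C' \<le> sum w C"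
    using finite_imageI[of F "sum w"] obtains_MAX[of F "sum w"] by (metis Max_ge imageI)
  have "w s \<le> w c" if cs: "c \<in> C" "s \<in> S" "\<phi> s \<notin> \<phi> ` C" for c s
  proof -
    have CS: "C \<subseteq> S" "inj_on \<phi> C" "card C = card T" and finC: "finite C"
      using C fin by (auto simp: F_def intro: finite_subset)
    have sC: "s \<notin> C" using cs(3) by blast
    have "insert s (C - {c}) \<in> F"
      using CS cs sC finC
      by (auto simp: F_def inj_on_insert card_Suc_Diff1 simp del: card_Diff_insert intro: inj_on_subset)
    from max[OF this] have "w s + sum w (C - {c}) \<le> sum w C" using sC finC by simp
    then show ?thesis using sum.remove[OF finC cs(1), of w] by simp
  qed
  then show ?thesis using C unfolding F_def w_def by blast
qed

text \<open>
  As in the Havel-Hakimi argument, both families are first brought to agree on one index, where they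
  take a transversal of the most frequent labels.
\<close>

lemma exchange_connected:
  assumes "finite I" "finite S" "labeled_partition \<phi> I S T" "labeled_partition \<phi> I S T'"
    "\<And>k. k \<in> I \<Longrightarrow> card (T k) = card (T' k)" "\<And>k. k \<notin> I \<Longrightarrow> T k = T' k"
  shows "(T, T') \<in> (exchange \<phi> I)\<^sup>*"
  using assms
proof (induction I arbitrary: S T T' rule: finite_induct)
  case empty
  then have "T = T'" by auto
  then show ?case by simp
next
  case (insert i I)
  let ?E = "exchange \<phi> (insert i I)"
  have iT: "T i \<subseteq> S" "inj_on \<phi> (T i)"
    using insert.prems(2) by (auto simp: labeled_partition_def)
  obtain C where C: "C \<subseteq> S" "inj_on \<phi> C" "card C = card (T i)"
    and top: "\<And>c s. c \<in> C \<Longrightarrow> s \<in> S \<Longrightarrow> \<phi> s \<notin> \<phi> ` C \<Longrightarrow>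
      card {x \<in> S. \<phi> x = \<phi> s} \<le> card {x \<in> S. \<phi> x = \<phi> c}"
    using ex_top_transversal[OF insert.prems(1) iT] by meson
  have fin: "finite (insert i I)" using insert.hyps by simp
  have reach: "\<exists>Z'. (Z, Z') \<in> ?E\<^sup>* \<and> Z' i = C"
    if "labeled_partition \<phi> (insert i I) S Z" "card (Z i) = card C" for Z
    by (rule exchange_reach_row[OF fin insert.prems(1) insertI1 C(1,2) _ that]) (rule top)
  obtain T1 where T1: "(T, T1) \<in> ?E\<^sup>*" "T1 i = C"
    using reach[OF insert.prems(2)] C(3) by metis
  obtain T2 where T2: "(T', T2) \<in> ?E\<^sup>*" "T2 i = C"
    using reach[OF insert.prems(3)] C(3) insert.prems(4)[of i] by (metis insertI1)
  have inv: "labeled_partition \<phi> (insert i I) S Z' \<and> (\<forall>k. card (Z' k) = card (Z k)) \<and>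
      (\<forall>k. k \<notin> insert i I \<longrightarrow> Z' k = Z k)"
    if "(Z, Z') \<in> ?E\<^sup>*" "labeled_partition \<phi> (insert i I) S Z" for Z Z'
    using that(1)
  proof (induction rule: rtrancl_induct)
    case base
    then show ?case using that(2) by simp
  next
    case (step Y Z)
    then show ?case
      using exchange_partition[OF step(2)] exchange_card[OF step(2)] exchange_outside[OF step(2)] by auto
  qed
  note inv1 = inv[OF T1(1) insert.prems(2)] and inv2 = inv[OF T2(1) insert.prems(3)]
  have sub: "labeled_partition \<phi> I (S - C) Z" if "labeled_partition \<phi> (insert i I) S Z" "Z i = C" for Z
    using that insert.hyps(2) by (auto simp: labeled_partition_def disjoint_family_on_def)
  \<comment> \<open>Both families have \<open>C\<close> at \<open>i\<close>, so their other parts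
    partition \<open>S - C\<close>, and they agree at \<open>i\<close>, as the induction hypothesis
    demands outside \<open>I\<close>.\<close>
  have "(T1, T2) \<in> (exchange \<phi> I)\<^sup>*"
  proof (rule insert.IH[of "S - C"])
    show "finite (S - C)" using insert.prems(1) by simp
    show "card (T1 k) = card (T2 k)" if "k \<in> I" for k
      using inv1 inv2 insert.prems(4)[of k] that by simp
    show "T1 k = T2 k" if "k \<notin> I" for k
      using inv1 inv2 insert.prems(5)[of k] that T1(2) T2(2) by (cases "k = i") auto
  qed (use sub inv1 inv2 T1(2) T2(2) in auto)
  then have "(T1, T2) \<in> ?E\<^sup>*" using rtrancl_mono[OF exchange_mono[of I "insert i I" \<phi>]] by blast
  \<comment> \<open>The path from \<open>T'\<close> is traversed backwards, since exchanges are
    symmetric.\<close>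
  moreover have "(T2, T') \<in> ?E\<^sup>*"
    using T2(1) sym_rtrancl[of ?E] exchange_sym[of _ _ \<phi> "insert i I"] by (meson symD symI)
  ultimately show ?case using T1(1) by (meson rtrancl_trans)
qed


section \<open>The spaces and the kernel\<close>

lemma count_sum_mset_image: "count (\<Sum>a\<in>#H. f a) s = (\<Sum>a\<in>#H. count (f a) s)"
  by (induction H) auto

lemma size_filter_eq_sum_of_bool: "size (filter_mset P H) = (\<Sum>a\<in>#H. of_bool (P a))"
  by (induction H) auto

lemma count_le_sum_mset: "a \<in># H \<Longrightarrow> count (f a) s \<le> (\<Sum>a\<in>#H. count (f a) s)"
  by (auto dest!: multi_member_split)

text \<open>A sum of natural numbers that is at most 1 has at most one nonzero summand, so one
  equation for each \<open>s\<close> encodes absence of repetition, membership in \<open>S\<close>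
  and unique occurrence. In this form only the sum of all tails (or heads) matters, and shuffles
  preserve that sum.\<close>

lemma unique_occurrence_iff:
  fixes f :: "'a \<Rightarrow> 's multiset"
  shows "((\<forall>a\<in>#H. no_repetition (f a) \<and> set_mset (f a) \<subseteq> S) \<and>
      (\<forall>s\<in>S. size {#a \<in># H. s \<in> set_mset (f a)#} = 1)) \<longleftrightarrow>
    (\<forall>s. (\<Sum>a\<in>#H. count (f a) s) = of_bool (s \<in> S))" (is "?L \<longleftrightarrow> ?R")
proof -
  have eq: "(\<Sum>a\<in>#H. count (f a) s) = size {#a \<in># H. s \<in> set_mset (f a)#}"
    if "\<forall>a\<in>#H. no_repetition (f a)" for s
    unfolding size_filter_eq_sum_of_bool
  proof (rule arg_cong[where f = sum_mset], rule image_mset_cong)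
    fix a assume "a \<in># H"
    then have "count (f a) s \<le> 1" using that by (auto simp: no_repetition_def)
    then have "count (f a) s = of_bool (0 < count (f a) s)" by (cases "count (f a) s") auto
    then show "count (f a) s = of_bool (s \<in># f a)" by (simp only: count_greater_zero_iff)
  qed
  show ?thesis
  proof
    assume L: ?L
    show ?R
    proof
      fix s
      have "s \<notin> S \<Longrightarrow> {#a \<in># H. s \<in> set_mset (f a)#} = {#}" using L by (auto simp: filter_mset_eq_conv)
      then show "(\<Sum>a\<in>#H. count (f a) s) = of_bool (s \<in> S)" using eq L by (cases "s \<in> S") auto
    qed
  next
    assume R: ?R
    have le: "count (f a) s \<le> of_bool (s \<in> S)" if "a \<in># H" for a s
      using count_le_sum_mset[OF that, of f s] R by simp
    have "no_repetition (f a) \<and> set_mset (f a) \<subseteq> S" if a: "a \<in># H" for a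
    proof -
      have "count (f a) s \<le> 1" for s using le[OF a, of s] by (cases "s \<in> S") auto
      moreover have "s \<in> S" if "s \<in># f a" for s
      proof -
        have "0 < count (f a) s" using that by simp
        then have "(0::nat) < of_bool (s \<in> S)" using le[OF a, of s] by linarith
        then show ?thesis by simp
      qed
      ultimately show ?thesis unfolding no_repetition_def by blast
    qed
    then have n: "\<forall>a\<in>#H. no_repetition (f a) \<and> set_mset (f a) \<subseteq> S" by blast
    then have "size {#a \<in># H. s \<in> set_mset (f a)#} = of_bool (s \<in> S)" for s
      using eq[of s] R by simp
    then show ?L using n by simp
  qed
qed

lemma stub_labeled_iff:
  "stub_labeled d H \<longleftrightarrow>
     (\<forall>s. (\<Sum>a\<in>#H. count (tail a) s) = of_bool (s \<in> out_stubs d)) \<and>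
     (\<forall>s. (\<Sum>a\<in>#H. count (head a) s) = of_bool (s \<in> in_stubs d))"
  unfolding unique_occurrence_iff[symmetric] stub_labeled_def
  by (simp only: ball_conj_distrib conj_ac)

lemma arc_degree_map_hyperarc [simp]: "arc_degree (map_hyperarc f a) = arc_degree a"
  by (cases a) (simp add: arc_degree_def)

lemma in_degree_underlying:
  "in_degree (underlying d H) v = count (image_mset vertex (\<Sum>a\<in>#H. head a)) v"
  unfolding in_degree_def underlying_def
  by (induction H) (auto simp: hyperarc.map_sel)

lemma out_degree_underlying:
  "out_degree (underlying d H) v = count (image_mset vertex (\<Sum>a\<in>#H. tail a)) v"
  unfolding out_degree_def underlying_def
  by (induction H) (auto simp: hyperarc.map_sel)

lemma dihypergraph_underlying:
  assumes "stub_labeled d H"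
  shows "dihypergraph (underlying d H) \<longleftrightarrow> finite (seq_verts d)"
proof -
  have "set_mset (tail (map_hyperarc vertex a)) \<subseteq> seq_verts d \<and>
      set_mset (head (map_hyperarc vertex a)) \<subseteq> seq_verts d" if "a \<in># H" for a
    using assms that unfolding stub_labeled_def out_stubs_def in_stubs_def
    by (fastforce simp: hyperarc.map_sel)
  then show ?thesis by (simp add: dihypergraph_def underlying_def)
qed

definition full_space :: "'v degree_seq \<Rightarrow> 'v stub_graph set" where
  "full_space d = stub_space {Self_Loops, Degenerate_Hyperarcs, Multi_Hyperarcs} d"

lemma full_space_iff:
  "H \<in> full_space d \<longleftrightarrow> finite (seq_verts d) \<and> stub_labeled d H \<and>
     (\<forall>v\<in>seq_verts d. count (image_mset vertex (\<Sum>a\<in>#H. head a)) v = seq_in d v \<and>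
       count (image_mset vertex (\<Sum>a\<in>#H. tail a)) v = seq_out d v) \<and>
     image_mset arc_degree H = seq_arcs d"
proof -
  have "f \<in> {Self_Loops, Degenerate_Hyperarcs, Multi_Hyperarcs}" for f by (cases f) auto
  moreover have "image_mset arc_degree (hyperarcs (underlying d H)) = image_mset arc_degree H"
    by (simp add: underlying_def multiset.map_comp comp_def)
  moreover have "verts (underlying d H) = seq_verts d" by (simp add: underlying_def)
  ultimately show ?thesis
    unfolding full_space_def stub_space_def has_degree_seq_def
      in_degree_underlying out_degree_underlying
    using dihypergraph_underlying[of d H] by auto
qed

text \<open>By the counting form of \<open>stub_labeled\<close>, membership depends only on the
  total tail, the total head and the multiset of arc degrees, the data kept by a shuffle.\<close>

lemma full_space_cong:
  assumes "H \<in> full_space d" "(\<Sum>a\<in>#H. tail a) = (\<Sum>a\<in>#H'. tail a)"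
    "(\<Sum>a\<in>#H. head a) = (\<Sum>a\<in>#H'. head a)" "image_mset arc_degree H = image_mset arc_degree H'"
  shows "H' \<in> full_space d"
  using assms unfolding full_space_iff stub_labeled_iff count_sum_mset_image[symmetric] by simp

lemma full_space_shuffle:
  assumes "add_mset a (add_mset b z) \<in> full_space d" "(a', b') \<in> shuffle_set a b"
  shows "add_mset a' (add_mset b' z) \<in> full_space d"
  by (rule full_space_cong[OF assms(1)])
    (use assms(2) in \<open>simp_all add: shuffle_set_def add.assoc[symmetric]\<close>)

text \<open>
  The labelling \<open>id\<close> imposes no condition, and \<open>vertex\<close> forbids degenerate hyperarcs, so that
  both spaces of the theorem are instances.
\<close>

definition labeled_space :: "('v stub \<Rightarrow> 'l) \<Rightarrow> 'v degree_seq \<Rightarrow> 'v stub_graph set" where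
  "labeled_space \<phi> d = {H \<in> full_space d.
     \<forall>a\<in>#H. inj_on \<phi> (set_mset (tail a)) \<and> inj_on \<phi> (set_mset (head a))}"

section \<open>The two spaces as labelled spaces\<close>

lemma mset_set_set_mset_if_no_repetition:
  assumes "no_repetition M"
  shows "mset_set (set_mset M) = M"
proof (rule multiset_eqI)
  fix x
  have "count M x \<le> 1" using assms by (simp add: no_repetition_def)
  then show "count (mset_set (set_mset M)) x = count M x"
    by (cases "x \<in># M") (auto simp: not_in_iff Suc_le_eq le_antisym)
qed

lemma no_repetition_image_iff:
  assumes "no_repetition M"
  shows "no_repetition (image_mset f M) \<longleftrightarrow> inj_on f (set_mset M)"
proof -
  have "count (image_mset f M) v = card {x \<in> set_mset M. f x = v}" for v
    by (subst mset_set_set_mset_if_no_repetition[OF assms, symmetric],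
        subst count_image_mset_eq_card_vimage) auto
  then show ?thesis
    by (auto simp: no_repetition_def card_le_Suc0_iff_eq inj_on_def)
qed

lemma not_degenerate_iff: "\<not> degenerate a \<longleftrightarrow> no_repetition (tail a) \<and> no_repetition (head a)"
  by (auto simp: degenerate_def no_repetition_def not_le less_Suc_eq_le numeral_2_eq_2)

lemma stub_space_eq_labeled_space:
  "stub_space {Self_Loops, Degenerate_Hyperarcs, Multi_Hyperarcs} d = labeled_space id d"
  by (auto simp: labeled_space_def full_space_def)

text \<open>\<open>Degenerate_Hyperarcs\<close> is the only excluded feature. As stubs do not repeat
  within a tail or head, degeneracy can only come from two stubs of the same vertex, that is, from
  \<open>vertex\<close> not being injective there.\<close>

lemma stub_space_nondegenerate_eq_labeled_space:
  "stub_space {Self_Loops, Multi_Hyperarcs} d = labeled_space vertex d"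
proof -
  have "(\<forall>f. f \<notin> {Self_Loops, Multi_Hyperarcs} \<longrightarrow> \<not> contains_feature G f) \<longleftrightarrow>
      (\<forall>a\<in>#hyperarcs G. \<not> degenerate a)" for G :: "'a dihypergraph"
    by (metis (full_types) contains_feature.simps(2) feature.distinct feature.exhaust insert_iff singletonD)
  moreover have "(\<forall>f. f \<notin> {Self_Loops, Degenerate_Hyperarcs, Multi_Hyperarcs} \<longrightarrow>
      \<not> contains_feature G f)" for G :: "'a dihypergraph"
    by (metis feature.exhaust insert_iff)
  moreover have "(\<forall>a\<in>#hyperarcs (underlying d H). \<not> degenerate a) \<longleftrightarrow>
      (\<forall>a\<in>#H. inj_on vertex (set_mset (tail a)) \<and> inj_on vertex (set_mset (head a)))"
    if "stub_labeled d H" for H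
  proof -
    have "no_repetition (tail a) \<and> no_repetition (head a)" if "a \<in># H" for a
      using that \<open>stub_labeled d H\<close> by (auto simp: stub_labeled_def)
    then show ?thesis
      by (auto simp: underlying_def not_degenerate_iff hyperarc.map_sel no_repetition_image_iff)
  qed
  ultimately show ?thesis
    unfolding labeled_space_def full_space_def stub_space_def by blast
qed

lemma labeled_space_shuffle:
  assumes "add_mset a (add_mset b z) \<in> labeled_space \<phi> d" "(a', b') \<in> shuffle_set a b"
    "inj_on \<phi> (set_mset (tail a'))" "inj_on \<phi> (set_mset (head a'))"
    "inj_on \<phi> (set_mset (tail b'))" "inj_on \<phi> (set_mset (head b'))"
  shows "add_mset a' (add_mset b' z) \<in> labeled_space \<phi> d"
  using assms full_space_shuffle unfolding labeled_space_def by auto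

lemma labeled_spaceD:
  assumes "H \<in> labeled_space \<phi> d"
  shows "stub_labeled d H" "size H = size (seq_arcs d)" "image_mset arc_degree H = seq_arcs d"
proof -
  show "stub_labeled d H" and *: "image_mset arc_degree H = seq_arcs d"
    using assms by (auto simp: labeled_space_def full_space_iff)
  show "size H = size (seq_arcs d)" using * by (metis size_image_mset)
qed

section \<open>Shuffles that change the hypergraph\<close>

lemma stub_labeled_count_le:
  assumes "stub_labeled d H" "arc_degree a \<noteq> (0, 0)"
  shows "count H a \<le> 1"
proof (rule ccontr)
  assume "\<not> count H a \<le> 1"
  then have "a \<in># H - {#a#}" by (simp add: in_diff_count)
  then obtain z where "H - {#a#} = add_mset a z" by (blast dest: multi_member_split)
  moreover have "a \<in># H" using \<open>a \<in># H - {#a#}\<close> by (rule in_diffD)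
  ultimately have z: "H = add_mset a (add_mset a z)" by (metis insert_DiffM)
  \<comment> \<open>The degree hypothesis gives \<open>a\<close> a stub, which would be counted
    twice if \<open>a\<close> occurred twice.\<close>
  consider s where "s \<in># tail a" | s where "s \<in># head a"
    using assms(2) by (auto simp: arc_degree_def)
  then show False
  proof cases
    case 1
    then have "0 < count (tail a) s" by simp
    moreover have "(\<Sum>a\<in>#H. count (tail a) s) \<le> 1" using assms(1) by (simp add: stub_labeled_iff)
    ultimately show False by (simp add: z del: count_greater_zero_iff)
  next
    case 2
    then have "0 < count (head a) s" by simp
    moreover have "(\<Sum>a\<in>#H. count (head a) s) \<le> 1" using assms(1) by (simp add: stub_labeled_iff)
    ultimately show False by (simp add: z del: count_greater_zero_iff)
  qed
qed

text \<open>The defining conditions are an equivalence relation on ordered pairs of hyperarcs, and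
  \<open>shuffle_set a b\<close> is the class of \<open>(a, b)\<close>. A shuffle and its reversal
  therefore choose from the same set.\<close>

lemma shuffle_set_eq: "(a', b') \<in> shuffle_set a b \<Longrightarrow> shuffle_set a' b' = shuffle_set a b"
  by (auto simp: shuffle_set_def)

lemma shuffle_set_sym: "(a', b') \<in> shuffle_set a b \<Longrightarrow> (a, b) \<in> shuffle_set a' b'"
  by (auto simp: shuffle_set_def)

text \<open>Once a new hyperarc coincides with an old one, cancellation in the sums of tails and
  heads determines the other, so the hypergraph stays unchanged.\<close>

lemma shuffle_set_overlap:
  assumes "(a', b') \<in> shuffle_set a b" "a' = a \<or> a' = b \<or> b' = a \<or> b' = b"
  shows "{#a', b'#} = {#a, b#}"
proof -
  have eq: "tail a + tail b = tail a' + tail b'" "head a + head b = head a' + head b'"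
    using assms(1) by (auto simp: shuffle_set_def)
  have "a' = a \<Longrightarrow> b' = b" "b' = b \<Longrightarrow> a' = a"
    using eq by (auto intro!: hyperarc.expand)
  moreover have "a' = b \<Longrightarrow> b' = a" "b' = a \<Longrightarrow> a' = b"
    using eq unfolding add.commute[of "tail a"] add.commute[of "head a"]
    by (auto intro!: hyperarc.expand)
  ultimately show ?thesis using assms(2) by (elim disjE) (simp_all add: add_mset_commute)
qed

lemma double_mset_eq_iff: "{#c, e#} = {#a, b#} \<longleftrightarrow> c = a \<and> e = b \<or> c = b \<and> e = a"
  by (auto simp: add_eq_conv_diff)

text \<open>
  Only hyperarcs with empty tail and head can be repeated, and a shuffle involving one of them changes
  nothing. Hence a proper transition determines the chosen pair of hyperarcs.
\<close>

definition transition ::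
  "'a hyperarc \<Rightarrow> 'a hyperarc \<Rightarrow> 'a hyperarc \<Rightarrow> 'a hyperarc \<Rightarrow> 'a hyperarc multiset \<Rightarrow>
   'a hyperarc multiset \<Rightarrow> 'a hyperarc multiset \<Rightarrow> bool" where
  "transition a b a' b' z x y \<longleftrightarrow>
     x = add_mset a (add_mset b z) \<and> y = add_mset a' (add_mset b' z) \<and> (a', b') \<in> shuffle_set a b \<and>
     a \<noteq> b \<and> a' \<noteq> b' \<and> {a, b} \<inter> {a', b'} = {} \<and> count x a = 1 \<and> count x b = 1 \<and>
     count y a' = 1 \<and> count y b' = 1"

lemma transition_sym: "transition a b a' b' z x y \<Longrightarrow> transition a' b' a b z y x"
  using shuffle_set_sym[of a' b' a b] by (auto simp: transition_def)

text \<open>New and old hyperarcs are disjoint, so \<open>x\<close> and \<open>y\<close> alone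
  reveal which hyperarcs were replaced.\<close>

lemma transition_diff:
  assumes "transition a b a' b' z x y"
  shows "x - y = {#a, b#}"
proof -
  have "x = z + {#a, b#}" "y = z + {#a', b'#}" and ne: "a' \<noteq> a" "a' \<noteq> b" "b' \<noteq> a" "b' \<noteq> b"
    using assms by (auto simp: transition_def)
  then have "x - y = {#a, b#} - {#a', b'#}" by (simp only: add_diff_cancel_left)
  also have "\<dots> = {#a, b#}" using ne by (auto simp: multiset_eq_iff)
  finally show ?thesis .
qed

lemma double_mset_subset_eqE:
  assumes "{#a, b#} \<subseteq># x"
  obtains z where "x = add_mset a (add_mset b z)"
proof
  have "x = {#a, b#} + (x - {#a, b#})" using subset_mset.add_diff_inverse[OF assms] by (rule sym)
  then show "x = add_mset a (add_mset b (x - {#a, b#}))" by simp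
qed

section \<open>Pairs of hyperarcs\<close>

lemma mem_unordered_pairsE:
  assumes "P \<in> unordered_pairs x"
  obtains a m b n where "P = {(a, m), (b, n)}" "(a, m) \<noteq> (b, n)" "m < count x a" "n < count x b"
    "{#a, b#} \<subseteq># x"
proof -
  obtain p q where pq: "P = {p, q}" "p \<noteq> q" "P \<subseteq> instances x"
    using assms by (auto simp: unordered_pairs_def card_2_iff)
  obtain a m b n where ab: "p = (a, m)" "q = (b, n)" by fastforce
  have "m < count x a" "n < count x b" using pq ab by (auto simp: instances_def)
  moreover have "a \<in># x" "b \<in># x" using calculation by (auto intro: count_inI)
  \<comment> \<open>If \<open>a = b\<close>, then \<open>m\<close> and \<open>n\<close> differ, so
    \<open>a\<close> has multiplicity at least 2 in \<open>x\<close>.\<close>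
  moreover have "{#a, b#} \<subseteq># x"
    using calculation pq(2) ab by (auto simp: subseteq_mset_def Suc_le_eq)
  ultimately show ?thesis using that pq ab by blast
qed

lemma finite_instances: "finite (instances x)"
  and card_instances: "card (instances x) = size x"
proof -
  have eq: "instances x = Sigma (set_mset x) (\<lambda>a. {..<count x a})"
    by (auto simp: instances_def intro: count_inI)
  show "finite (instances x)" unfolding eq by simp
  show "card (instances x) = size x" unfolding eq by (simp add: size_multiset_overloaded_eq)
qed

lemma finite_unordered_pairs: "finite (unordered_pairs x)"
  unfolding unordered_pairs_def
  by (rule finite_subset[of _ "Pow (instances x)"]) (auto simp: finite_instances)

lemma card_unordered_pairs: "card (unordered_pairs x) = size x choose 2"
  unfolding unordered_pairs_def
  using n_subsets[OF finite_instances, of x 2] by (simp add: card_instances)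

lemma unordered_pairs_nonempty: "2 \<le> size x \<Longrightarrow> unordered_pairs x \<noteq> {}"
  using zero_less_binomial[of 2 "size x"] card_unordered_pairs[of x] by (metis card.empty less_numeral_extra(3))

lemma ex_unordered_pair:
  assumes "{#a, b#} \<subseteq># x"
  obtains m n where "{(a, m), (b, n)} \<in> unordered_pairs x"
proof (cases "a = b")
  case True
  have "count {#a, b#} a \<le> count x a" using assms by (rule mset_subset_eq_count)
  then have "2 \<le> count x a" using True by simp
  then have "{(a, 0), (b, 1)} \<in> unordered_pairs x"
    using True by (simp add: unordered_pairs_def instances_def del: count_greater_zero_iff)
  then show ?thesis by (rule that)
next
  case False
  have "count {#a, b#} a \<le> count x a" "count {#a, b#} b \<le> count x b"
    by (rule mset_subset_eq_count[OF assms])+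
  then have "{(a, 0), (b, 0)} \<in> unordered_pairs x"
    using False by (simp add: unordered_pairs_def instances_def)
  then show ?thesis by (rule that)
qed

section \<open>One-step probabilities and their symmetry\<close>

lemma pmf_shuffle:
  "pmf (shuffle x a b) y =
    card {(c, e) \<in> shuffle_set a b. x - {#a, b#} + {#c, e#} = y} / card (shuffle_set a b)"
proof -
  have "shuffle_set a b \<noteq> {}" using mem_shuffle_set by blast
  moreover have "shuffle_set a b \<inter> (\<lambda>(a', b'). x - {#a, b#} + {#a', b'#}) -` {y} =
      {(c, e) \<in> shuffle_set a b. x - {#a, b#} + {#c, e#} = y}" by auto
  ultimately show ?thesis
    unfolding shuffle_def pmf_map using finite_shuffle_set[of a b]
    by (subst measure_pmf_of_set) simp_all
qed

text \<open>A shuffle that changes \<open>x\<close> keeps neither hyperarc, by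
  \<open>shuffle_set_overlap\<close>, so both contain a stub and occur once. The chosen copies then
  carry the number 0.\<close>

lemma transition_if_pmf_nonzero:
  assumes x: "stub_labeled d x" and y: "stub_labeled d y" and "y \<noteq> x" and P: "P \<in> unordered_pairs x"
    and nz: "pmf (shuffle_pair x P) y \<noteq> 0"
  shows "\<exists>a b a' b' z. P = {(a, 0), (b, 0)} \<and> transition a b a' b' z x y"
proof -
  obtain a m b n where ab: "P = {(a, m), (b, n)}" "(a, m) \<noteq> (b, n)" "m < count x a" "n < count x b"
    "{#a, b#} \<subseteq># x"
    using mem_unordered_pairsE[OF P] by blast
  obtain z where xz: "x = add_mset a (add_mset b z)" using ab(5) by (rule double_mset_subset_eqE)
  have "{(c, e) \<in> shuffle_set a b. x - {#a, b#} + {#c, e#} = y} \<noteq> {}"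
    using nz unfolding ab(1) shuffle_pair_eq fst_conv pmf_shuffle
    by (rule contrapos_nn) (simp only: card.empty of_nat_0 div_0)
  then obtain a' b' where S: "(a', b') \<in> shuffle_set a b" and yz: "y = add_mset a' (add_mset b' z)"
    unfolding xz by auto
  have ne: "\<not> (a' = a \<or> a' = b \<or> b' = a \<or> b' = b)"
  proof
    assume "a' = a \<or> a' = b \<or> b' = a \<or> b' = b"
    from shuffle_set_overlap[OF S this] have "{#a', b'#} + z = {#a, b#} + z" by (rule arg_cong)
    then show False using \<open>y \<noteq> x\<close> by (simp add: xz yz)
  qed
  have deg: "arc_degree a' = arc_degree a" "arc_degree b' = arc_degree b"
    using S by (auto simp: shuffle_set_def)
  \<comment> \<open>There is only one hyperarc with empty tail and head, so degree
    \<open>(0, 0)\<close> would force \<open>a' = a\<close> or \<open>b' = b\<close>.\<close>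
  have nonempty: "arc_degree a \<noteq> (0, 0)" "arc_degree b \<noteq> (0, 0)"
    using deg ne by (auto simp: arc_degree_def intro!: hyperarc.expand)
  have le: "count x a \<le> 1" "count x b \<le> 1" "count y a' \<le> 1" "count y b' \<le> 1"
    using stub_labeled_count_le[OF x] stub_labeled_count_le[OF y] nonempty deg by auto
  then have "a \<noteq> b" "a' \<noteq> b'" unfolding xz yz by auto
  moreover have "count x a = 1" "count x b = 1" "count y a' = 1" "count y b' = 1"
    using le by (auto simp: xz yz)
  moreover from this have "P = {(a, 0), (b, 0)}" using ab(1,3,4) by simp
  moreover have "{a, b} \<inter> {a', b'} = {}" using ne by blast
  ultimately have "P = {(a, 0), (b, 0)} \<and> transition a b a' b' z x y"
    unfolding transition_def using xz yz S by (intro conjI) assumption+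
  then show ?thesis by (intro exI)
qed

lemma pmf_shuffle_step:
  assumes "y \<in> X" "y \<noteq> x" "2 \<le> size x"
  shows "pmf (shuffle_step X x) y = (\<Sum>P\<in>unordered_pairs x. pmf (shuffle_pair x P) y) / (size x choose 2)"
proof -
  \<comment> \<open>Rejection returns \<open>x\<close>, which is not \<open>y\<close>, and the
    outcome \<open>y\<close> is always accepted, so filtering does not affect the probability of
    \<open>y\<close>.\<close>
  have "pmf (map_pmf (\<lambda>H'. if H' \<in> X then H' else x) M) y = pmf M y" for M
  proof -
    have "(\<lambda>H'. if H' \<in> X then H' else x) -` {y} = {y}" using assms by auto
    then show ?thesis unfolding pmf_map by (simp add: measure_pmf_single)
  qed
  then show ?thesis
    unfolding shuffle_step_def
    by (subst pmf_bind_pmf_of_set[OF unordered_pairs_nonempty[OF assms(3)] finite_unordered_pairs])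
      (simp add: card_unordered_pairs)
qed

text \<open>By \<open>transition_diff\<close> exactly one chosen pair can lead to \<open>y\<close>.
  The numerator 2 arises when the degrees agree, because \<open>(a', b')\<close> and
  \<open>(b', a')\<close> are then two outcomes with the same resulting hypergraph.\<close>

lemma pmf_shuffle_step_transition:
  assumes x: "stub_labeled d x" and y: "stub_labeled d y" "y \<in> X" and "2 \<le> size x"
    and tr: "transition a b a' b' z x y"
  shows "pmf (shuffle_step X x) y =
    (if arc_degree a = arc_degree b then 2 else 1) / (card (shuffle_set a b) * (size x choose 2))"
proof -
  note t = tr[unfolded transition_def]
  have xy: "y \<noteq> x" using transition_diff[OF tr] by auto
  have P0: "{(a, 0), (b, 0)} \<in> unordered_pairs x"
    using t by (auto simp: unordered_pairs_def instances_def)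
  have "pmf (shuffle_pair x P) y = 0" if P: "P \<in> unordered_pairs x - {{(a, 0), (b, 0)}}" for P
  proof (rule ccontr)
    assume nz: "pmf (shuffle_pair x P) y \<noteq> 0"
    have "P \<in> unordered_pairs x" using P by simp
    from transition_if_pmf_nonzero[OF x y(1) xy this nz]
    obtain a2 b2 a2' b2' z2 where P2: "P = {(a2, 0), (b2, 0)}" and "transition a2 b2 a2' b2' z2 x y"
      by blast
    then have "{#a2, b2#} = {#a, b#}" using transition_diff tr by metis
    then have "P = {(a, 0), (b, 0)}" unfolding P2 by (auto simp: double_mset_eq_iff)
    then show False using P by simp
  qed
  then have "(\<Sum>P\<in>unordered_pairs x. pmf (shuffle_pair x P) y) = pmf (shuffle_pair x {(a, 0), (b, 0)}) y"
    using finite_unordered_pairs[of x] P0 by (subst sum.remove) auto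
  also have "\<dots> = pmf (shuffle x a b) y" by (simp add: shuffle_pair_eq)
  also have "\<dots> = card {(c, e) \<in> shuffle_set a b. {#c, e#} = {#a', b'#}} / card (shuffle_set a b)"
  proof -
    have "x - {#a, b#} + {#c, e#} = y \<longleftrightarrow> {#c, e#} = {#a', b'#}" for c e
    proof -
      have "x - {#a, b#} = z" "y = z + {#a', b'#}" using t by auto
      then show ?thesis by (metis add_left_cancel)
    qed
    then show ?thesis unfolding pmf_shuffle by simp
  qed
  also have "card {(c, e) \<in> shuffle_set a b. {#c, e#} = {#a', b'#}} =
      (if arc_degree a = arc_degree b then 2 else 1)"
  proof -
    have S: "(a', b') \<in> shuffle_set a b" and ne: "a' \<noteq> b'" using t by auto
    then have "(b', a') \<in> shuffle_set a b \<longleftrightarrow> arc_degree a = arc_degree b"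
      by (auto simp: shuffle_set_def add.commute)
    then have "{(c, e) \<in> shuffle_set a b. {#c, e#} = {#a', b'#}} =
        (if arc_degree a = arc_degree b then {(a', b'), (b', a')} else {(a', b')})"
      using S by (auto simp: double_mset_eq_iff)
    then show ?thesis using ne by simp
  qed
  finally show ?thesis
    unfolding pmf_shuffle_step[OF y(2) xy assms(4)] by simp
qed

text \<open>Every ingredient of the formula for a transition is the same for the reversed one: the
  shuffle set, the arc degrees and the number of hyperarcs.\<close>

lemma shuffle_step_sym_if_nonzero:
  assumes "stub_labeled d x" "x \<in> X" "stub_labeled d y" "y \<in> X" "2 \<le> size x" "size y = size x" "y \<noteq> x"
    and "pmf (shuffle_step X x) y \<noteq> 0"
  shows "pmf (shuffle_step X x) y = pmf (shuffle_step X y) x"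
proof -
  have "\<exists>P\<in>unordered_pairs x. pmf (shuffle_pair x P) y \<noteq> 0"
    using assms(8) unfolding pmf_shuffle_step[OF assms(4,7,5)]
    by (rule contrapos_np) (simp add: sum.neutral)
  then obtain a b a' b' z where tr: "transition a b a' b' z x y"
    using transition_if_pmf_nonzero[OF assms(1,3,7)] by blast
  then have S: "(a', b') \<in> shuffle_set a b" by (simp add: transition_def)
  then have "arc_degree a' = arc_degree a" "arc_degree b' = arc_degree b"
    by (auto simp: shuffle_set_def)
  then show ?thesis
    using pmf_shuffle_step_transition[OF assms(1,3,4,5) tr]
      pmf_shuffle_step_transition[OF assms(3,1,2) _ transition_sym[OF tr]] assms(5,6)
    by (simp add: shuffle_set_eq[OF S])
qed

lemma shuffle_step_sym:
  assumes "stub_labeled d x" "x \<in> X" "stub_labeled d y" "y \<in> X" "2 \<le> size x" "size y = size x"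
  shows "pmf (shuffle_step X x) y = pmf (shuffle_step X y) x"
proof (cases "y = x")
  case False
  then have "pmf (shuffle_step X x) y \<noteq> 0 \<Longrightarrow> ?thesis"
    using shuffle_step_sym_if_nonzero[OF assms] by blast
  moreover have ?thesis if nz: "pmf (shuffle_step X y) x \<noteq> 0"
  proof -
    have size: "2 \<le> size y" "size x = size y" "x \<noteq> y" using assms(5,6) False by auto
    show ?thesis by (rule sym[OF shuffle_step_sym_if_nonzero[OF assms(3,4,1,2) size nz]])
  qed
  ultimately show ?thesis by linarith
qed simp

text \<open>The choice \<open>(a', b') = (a, b)\<close> is allowed and gives laziness; other choices
  give the edges for irreducibility.\<close>

lemma shuffle_step_reaches:
  assumes "add_mset a' (add_mset b' z) \<in> X" "(a', b') \<in> shuffle_set a b"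
  shows "0 < pmf (shuffle_step X (add_mset a (add_mset b z))) (add_mset a' (add_mset b' z))"
proof -
  let ?x = "add_mset a (add_mset b z)" and ?y = "add_mset a' (add_mset b' z)"
  obtain m n where P: "{(a, m), (b, n)} \<in> unordered_pairs ?x"
    by (rule ex_unordered_pair[of a b ?x]) auto
  have "?y \<in> set_pmf (shuffle ?x a b)"
    unfolding shuffle_def set_map_pmf
    using assms(2) finite_shuffle_set[of a b]
    by (subst set_pmf_of_set) (auto intro!: image_eqI[of _ _ "(a', b')"])
  then have "?y \<in> set_pmf (shuffle_pair ?x {(a, m), (b, n)})" by (simp add: shuffle_pair_eq)
  then have "?y \<in> set_pmf (shuffle_step X ?x)"
    unfolding shuffle_step_def set_bind_pmf set_map_pmf using P finite_unordered_pairs assms(1)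
    by (subst set_pmf_of_set) (auto intro!: bexI[OF _ P] image_eqI[of _ _ ?y])
  then show ?thesis by (simp add: pmf_positive)
qed

lemma set_pmf_shuffle_step: "x \<in> X \<Longrightarrow> set_pmf (shuffle_step X x) \<subseteq> X"
  by (auto simp: shuffle_step_def)

lemma shuffle_step_lazy:
  assumes "x \<in> X" "2 \<le> size x"
  shows "0 < pmf (shuffle_step X x) x"
proof -
  obtain P where "P \<in> unordered_pairs x" using unordered_pairs_nonempty[OF assms(2)] by blast
  then obtain a m b n where "{#a, b#} \<subseteq># x" by (rule mem_unordered_pairsE)
  then obtain z where "x = add_mset a (add_mset b z)" by (rule double_mset_subset_eqE)
  then show ?thesis using shuffle_step_reaches[OF _ mem_shuffle_set] assms(1) by blast
qed


section \<open>Irreducibility and convergence\<close>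

text \<open>Tails and heads are separate families over the same numbers, so that one can be
  rearranged while the other rests. \<open>image_mset\<close> forgets the numbering but keeps
  repeated empty hyperarcs.\<close>

definition family_graph :: "'i set \<Rightarrow> ('i \<Rightarrow> 's set) \<Rightarrow> ('i \<Rightarrow> 's set) \<Rightarrow> 's hyperarc multiset" where
  "family_graph I T U = image_mset (\<lambda>k. Hyperarc (mset_set (T k)) (mset_set (U k))) (mset_set I)"

definition shuffle_edges :: "'a hyperarc multiset set \<Rightarrow> ('a hyperarc multiset \<times> 'a hyperarc multiset) set" where
  "shuffle_edges X = {(x, y). x \<in> X \<and> y \<in> X \<and> 0 < pmf (shuffle_step X x) y}"

lemma exchange_at_mset_set:
  assumes "exchange_at \<phi> i j T T'"
  shows "mset_set (T i) + mset_set (T j) = mset_set (T' i) + mset_set (T' j)"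
proof -
  have *: "T' i \<union> T' j = T i \<union> T j" "T i \<inter> T j = {}" "T' i \<inter> T' j = {}" "finite (T i \<union> T j)"
    using assms unfolding exchange_at_def by simp_all
  then have fin: "finite (T i)" "finite (T j)" "finite (T' i)" "finite (T' j)"
    by (metis finite_Un)+
  have "mset_set (T i \<union> T j) = mset_set (T i) + mset_set (T j)"
    using fin *(2) by (intro mset_set_Union)
  moreover have "mset_set (T' i \<union> T' j) = mset_set (T' i) + mset_set (T' j)"
    using fin *(3) by (intro mset_set_Union)
  ultimately show ?thesis using *(1) by simp
qed

text \<open>Finiteness matters because \<open>mset_set\<close> turns an infinite set into the empty
  multiset.\<close>

lemma exchange_at_finite:
  assumes "exchange_at \<phi> i j T T'"
  shows "finite (T' i)" "finite (T' j)"
proof -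
  have "finite (T' i \<union> T' j)" using exchange_at_sym[OF assms] unfolding exchange_at_def by blast
  then show "finite (T' i)" "finite (T' j)" by auto
qed

text \<open>Exchanges of tails and of heads at the same two indices combine into a single shuffle of
  the hyperarcs numbered \<open>i\<close> and \<open>j\<close>.\<close>

lemma exchange_at_shuffle_edge:
  fixes d :: "'v degree_seq"
  assumes I: "finite I" "i \<in> I" "j \<in> I"
    and T: "exchange_at \<phi> i j T T'" and U: "exchange_at \<phi> i j U U'"
    and x: "family_graph I T U \<in> labeled_space \<phi> d"
  shows "(family_graph I T U, family_graph I T' U') \<in> shuffle_edges (labeled_space \<phi> d)"
proof -
  define arc where "arc T U k = Hyperarc (mset_set (T k)) (mset_set (U k))" for T U :: "'a \<Rightarrow> 'v stub set" and k
  define z where "z = image_mset (arc T U) (mset_set (I - {i, j}))"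
  have ij: "i \<noteq> j" using T unfolding exchange_at_def by simp
  have "I = insert i (insert j (I - {i, j}))" using I by blast
  then have I_eq: "mset_set I = add_mset i (add_mset j (mset_set (I - {i, j})))"
    using I(1) ij by (metis DiffD2 finite_Diff finite_insert insertCI insertE mset_set.insert)
  have 1: "family_graph I T U = add_mset (arc T U i) (add_mset (arc T U j) z)"
    unfolding family_graph_def I_eq z_def arc_def by simp
  have out: "T' k = T k" "U' k = U k" if "k \<in> I - {i, j}" for k
    using T U that unfolding exchange_at_def by auto
  have "image_mset (arc T' U') (mset_set (I - {i, j})) = z"
    unfolding z_def by (rule image_mset_cong) (use out I(1) in \<open>auto simp: arc_def\<close>)
  then have 2: "family_graph I T' U' = add_mset (arc T' U' i) (add_mset (arc T' U' j) z)"
    unfolding family_graph_def I_eq arc_def by simp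
  have card: "card (T' i) = card (T i)" "card (T' j) = card (T j)"
      "card (U' i) = card (U i)" "card (U' j) = card (U j)"
    using T U unfolding exchange_at_def by simp_all
  have S: "(arc T' U' i, arc T' U' j) \<in> shuffle_set (arc T U i) (arc T U j)"
    using exchange_at_mset_set[OF T] exchange_at_mset_set[OF U] card
    by (simp add: shuffle_set_def arc_def arc_degree_def)
  have inj: "inj_on \<phi> (T' i)" "inj_on \<phi> (T' j)" "inj_on \<phi> (U' i)" "inj_on \<phi> (U' j)"
    using T U unfolding exchange_at_def by simp_all
  have "family_graph I T' U' \<in> labeled_space \<phi> d"
    unfolding 2
    by (rule labeled_space_shuffle[OF x[unfolded 1] S])
      (use inj exchange_at_finite[OF T] exchange_at_finite[OF U] in \<open>simp_all add: arc_def\<close>)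
  then show ?thesis
    using x shuffle_step_reaches[OF _ S, of z "labeled_space \<phi> d"]
    unfolding shuffle_edges_def 1 2 by simp
qed

lemma exchange_at_refl:
  assumes "labeled_partition \<phi> I S T" "finite S" "i \<in> I" "j \<in> I" "i \<noteq> j"
  shows "exchange_at \<phi> i j T T"
proof -
  have "T i \<union> T j \<subseteq> S" "T i \<inter> T j = {}" "inj_on \<phi> (T i)" "inj_on \<phi> (T j)"
    using assms unfolding labeled_partition_def disjoint_family_on_def by blast+
  then show ?thesis
    using assms(2,5) finite_subset unfolding exchange_at_def by metis
qed

text \<open>All tails are moved before any head. The mixed hypergraphs stay in the space because the
  label condition constrains tails and heads separately; while one family moves,
  \<open>exchange_at_refl\<close> supplies the trivial exchange of the other.\<close>

lemma exchange_rtrancl_shuffle_edges: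
  assumes I: "finite I"
    and T: "labeled_partition \<phi> I S T" "finite S" and U: "labeled_partition \<phi> I S' U" "finite S'"
    and TT': "(T, T') \<in> (exchange \<phi> I)\<^sup>*" and UU': "(U, U') \<in> (exchange \<phi> I)\<^sup>*"
    and x: "family_graph I T U \<in> labeled_space \<phi> d"
  shows "(family_graph I T U, family_graph I T' U') \<in> (shuffle_edges (labeled_space \<phi> d))\<^sup>*"
proof -
  let ?X = "labeled_space \<phi> d"
  have "(family_graph I T U, family_graph I T' U) \<in> (shuffle_edges ?X)\<^sup>* \<and>
      family_graph I T' U \<in> ?X \<and> labeled_partition \<phi> I S T'"
    using TT'
  proof (induction rule: rtrancl_induct)
    case base
    then show ?case using x T by simp
  next
    case (step Y Z)
    obtain i j where ij: "i \<in> I" "j \<in> I" "exchange_at \<phi> i j Y Z"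
      using step(2) by (rule exchangeE)
    then have "i \<noteq> j" unfolding exchange_at_def by simp
    from exchange_at_refl[OF U ij(1,2) this]
    have "(family_graph I Y U, family_graph I Z U) \<in> shuffle_edges ?X"
      using exchange_at_shuffle_edge[OF I ij] step.IH by blast
    moreover from this have "family_graph I Z U \<in> ?X" by (simp add: shuffle_edges_def)
    ultimately show ?case
      using step.IH exchange_partition[OF step(2)] by (meson rtrancl.rtrancl_into_rtrancl)
  qed
  then have T': "(family_graph I T U, family_graph I T' U) \<in> (shuffle_edges ?X)\<^sup>*"
      "family_graph I T' U \<in> ?X" "labeled_partition \<phi> I S T'" by blast+
  have "(family_graph I T' U, family_graph I T' U') \<in> (shuffle_edges ?X)\<^sup>* \<and> family_graph I T' U' \<in> ?X"
    using UU'
  proof (induction rule: rtrancl_induct)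
    case base
    then show ?case using T' by simp
  next
    case (step Y Z)
    obtain i j where ij: "i \<in> I" "j \<in> I" "exchange_at \<phi> i j Y Z"
      using step(2) by (rule exchangeE)
    then have "i \<noteq> j" unfolding exchange_at_def by simp
    from exchange_at_refl[OF T'(3) T(2) ij(1,2) this]
    have "(family_graph I T' Y, family_graph I T' Z) \<in> shuffle_edges ?X"
      using exchange_at_shuffle_edge[OF I ij(1,2) _ ij(3)] step.IH by blast
    moreover from this have "family_graph I T' Z \<in> ?X" by (simp add: shuffle_edges_def)
    ultimately show ?case
      using step.IH by (meson rtrancl.rtrancl_into_rtrancl)
  qed
  then show ?thesis using T'(1) by (meson rtrancl_trans)
qed

text \<open>The counts of an element over all positions add up to at most 1, so no two parts share
  it; the sum is nonzero exactly on \<open>S\<close>, so the parts cover \<open>S\<close>.\<close>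

lemma labeled_partition_of_list:
  fixes f :: "'a \<Rightarrow> 's multiset"
  assumes sum: "\<And>s. (\<Sum>a\<in>#mset xs. count (f a) s) = of_bool (s \<in> S)"
    and inj: "\<And>a. a \<in> set xs \<Longrightarrow> inj_on \<phi> (set_mset (f a))"
    and T: "\<And>k. k < length xs \<Longrightarrow> T k = set_mset (f (xs ! k))"
  shows "labeled_partition \<phi> {..<length xs} S T"
proof -
  have sum': "(\<Sum>k<length xs. count (f (xs ! k)) s) = of_bool (s \<in> S)" for s
  proof -
    have "(\<Sum>a\<in>#mset xs. count (f a) s) = sum_list (map (\<lambda>a. count (f a) s) xs)"
      by (subst mset_map[symmetric]) (rule sum_mset_sum_list)
    then show ?thesis using sum[of s] by (simp add: sum_list_sum_nth atLeast0LessThan)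
  qed
  have "T i \<inter> T j = {}" if "i < length xs" "j < length xs" "i \<noteq> j" for i j
  proof (rule ccontr)
    assume "T i \<inter> T j \<noteq> {}"
    then obtain s where "s \<in> T i" "s \<in> T j" by blast
    then have "0 < count (f (xs ! i)) s" "0 < count (f (xs ! j)) s" using that T by simp_all
    moreover have "(\<Sum>k\<in>{i, j}. count (f (xs ! k)) s) \<le> (\<Sum>k<length xs. count (f (xs ! k)) s)"
      using that by (intro sum_mono2) auto
    moreover have "(\<Sum>k\<in>{i, j}. count (f (xs ! k)) s) = count (f (xs ! i)) s + count (f (xs ! j)) s"
      using that(3) by simp
    moreover have "of_bool (s \<in> S) \<le> (1::nat)" by simp
    ultimately show False using sum'[of s] by linarith
  qed
  moreover have "(\<Union>k<length xs. T k) = S"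
  proof -
    have "s \<in> S \<longleftrightarrow> (\<exists>k<length xs. s \<in># f (xs ! k))" for s
    proof -
      have "s \<in> S \<longleftrightarrow> (\<Sum>k<length xs. count (f (xs ! k)) s) \<noteq> 0" unfolding sum' by simp
      then show ?thesis by (auto simp: not_in_iff)
    qed
    then show ?thesis using T by auto
  qed
  moreover have "inj_on \<phi> (T k)" if "k < length xs" for k using inj T that by simp
  ultimately show ?thesis
    by (simp add: labeled_partition_def disjoint_family_on_def)
qed

lemma labeled_space_connected:
  assumes x: "x \<in> labeled_space \<phi> d" and y: "y \<in> labeled_space \<phi> d"
  shows "(x, y) \<in> (shuffle_edges (labeled_space \<phi> d))\<^sup>*"
proof -
  \<comment> \<open>Equal multisets of arc degrees let the hyperarcs of \<open>x\<close> and
    \<open>y\<close> be listed so that degrees agree position by position.\<close>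
  have "rel_mset (=) (image_mset arc_degree x) (image_mset arc_degree y)"
    using labeled_spaceD(3)[OF x] labeled_spaceD(3)[OF y] by (simp add: multiset.rel_eq)
  then have "rel_mset (\<lambda>a b. arc_degree a = arc_degree b) x y" by (simp only: multiset.rel_map)
  then obtain xs ys where xs: "mset xs = x" and ys: "mset ys = y"
    and deg: "list_all2 (\<lambda>a b. arc_degree a = arc_degree b) xs ys"
    unfolding rel_mset_def by blast
  have len: "length ys = length xs" using deg by (simp add: list_all2_lengthD)
  \<comment> \<open>The default \<open>{}\<close> makes the families of two lists of equal length
    agree beyond the lists, as \<open>exchange_connected\<close> requires outside the index
    set.\<close>
  define fam where "fam f zs k = (if k < length zs then set_mset (f (zs ! k)) else {})"
    for f :: "'a stub hyperarc \<Rightarrow> 'a stub multiset" and zs k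
  have part: "labeled_partition \<phi> {..<length zs} (out_stubs d) (fam tail zs)"
      "labeled_partition \<phi> {..<length zs} (in_stubs d) (fam head zs)"
      "family_graph {..<length zs} (fam tail zs) (fam head zs) = mset zs"
      "\<And>a. a \<in> set zs \<Longrightarrow> size (tail a) = card (set_mset (tail a)) \<and> size (head a) = card (set_mset (head a))"
    if zs: "mset zs \<in> labeled_space \<phi> d" for zs
  proof -
    have lab: "stub_labeled d (mset zs)" by (rule labeled_spaceD(1)[OF zs])
    show "labeled_partition \<phi> {..<length zs} (out_stubs d) (fam tail zs)"
      using lab zs by (intro labeled_partition_of_list[of tail zs])
        (auto simp: stub_labeled_iff labeled_space_def fam_def)
    show "labeled_partition \<phi> {..<length zs} (in_stubs d) (fam head zs)"
      using lab zs by (intro labeled_partition_of_list[of head zs])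
        (auto simp: stub_labeled_iff labeled_space_def fam_def)
    have rep: "mset_set (set_mset (tail a)) = tail a" "mset_set (set_mset (head a)) = head a"
      if "a \<in> set zs" for a
      using lab that by (auto simp: stub_labeled_def intro!: mset_set_set_mset_if_no_repetition)
    then show "size (tail a) = card (set_mset (tail a)) \<and> size (head a) = card (set_mset (head a))"
      if "a \<in> set zs" for a
      using that by (metis size_mset_set)
    have "image_mset (\<lambda>k. Hyperarc (mset_set (fam tail zs k)) (mset_set (fam head zs k))) (mset_set {..<length zs})
        = image_mset (\<lambda>k. zs ! k) (mset_set {..<length zs})"
      by (rule image_mset_cong) (simp add: fam_def rep)
    also have "\<dots> = mset (map (\<lambda>k. zs ! k) [0..<length zs])"
      by (simp only: mset_map mset_set_upto_eq_mset_upto)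
    finally show "family_graph {..<length zs} (fam tail zs) (fam head zs) = mset zs"
      unfolding family_graph_def map_nth .
  qed
  note px = part[of xs, unfolded xs, OF x] and py = part[of ys, unfolded ys len, OF y]
  let ?I = "{..<length xs}"
  have card: "card (fam tail xs k) = card (fam tail ys k)" "card (fam head xs k) = card (fam head ys k)"
    if "k \<in> ?I" for k
  proof -
    have k: "k < length xs" "xs ! k \<in> set xs" "ys ! k \<in> set ys" using that len by auto
    have "arc_degree (xs ! k) = arc_degree (ys ! k)" using deg k(1) by (simp add: list_all2_conv_all_nth)
    then show "card (fam tail xs k) = card (fam tail ys k)" "card (fam head xs k) = card (fam head ys k)"
      using px(4)[OF k(2)] py(4)[OF k(3)] k(1) len by (simp_all add: fam_def arc_degree_def)
  qed
  have outside: "fam f xs k = fam f ys k" if "k \<notin> ?I" for f k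
    using that len by (simp add: fam_def)
  have finite_union: "finite S" if "labeled_partition \<phi> ?I S (fam f xs)" for S f
    using that by (auto simp: labeled_partition_def fam_def)
  have fin: "finite (out_stubs d)" "finite (in_stubs d)"
    using finite_union px(1,2) by blast+
  have tails: "(fam tail xs, fam tail ys) \<in> (exchange \<phi> ?I)\<^sup>*"
    by (rule exchange_connected[OF _ fin(1) px(1) py(1) card(1) outside]) auto
  have heads: "(fam head xs, fam head ys) \<in> (exchange \<phi> ?I)\<^sup>*"
    by (rule exchange_connected[OF _ fin(2) px(2) py(2) card(2) outside]) auto
  show ?thesis
    using exchange_rtrancl_shuffle_edges[OF _ px(1) fin(1) px(2) fin(2) tails heads] x
    unfolding px(3) py(3) by blast
qed

section \<open>Convergence of the method\<close>

lemma set_pmf_shuffling_method: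
  assumes "H\<^sub>0 \<in> X"
  shows "set_pmf (shuffling_method X H\<^sub>0 k) \<subseteq> X"
proof (induction k)
  case (Suc k)
  have "set_pmf (shuffle_step X x) \<subseteq> X" if "x \<in> set_pmf (shuffling_method X H\<^sub>0 k)" for x
    using that Suc by (intro set_pmf_shuffle_step) (rule subsetD)
  then show ?case unfolding shuffling_method.simps set_bind_pmf by (intro UN_least)
qed (use assms in simp)

lemma labeled_space_converges:
  fixes H\<^sub>0 :: "'v stub_graph"
  assumes size: "2 \<le> size (seq_arcs d)" and H: "H\<^sub>0 \<in> labeled_space \<phi> d"
  shows "converges_in_distribution (shuffling_method (labeled_space \<phi> d) H\<^sub>0)
    (pmf_of_set (labeled_space \<phi> d))"
proof -
  define X where "X = labeled_space \<phi> d"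
  define p where "p k = pmf (shuffling_method X H\<^sub>0 k)" for k
  have fin: "finite X"
    unfolding X_def labeled_space_def full_space_def
    by (rule finite_subset[OF _ finite_stub_space]) (rule Collect_restrict)
  have ne: "X \<noteq> {}" using H X_def by blast
  note supp = set_pmf_shuffling_method[OF H[folded X_def]]
  have sizes: "2 \<le> size x" "size x = size (seq_arcs d)" "stub_labeled d x" if "x \<in> X" for x
    using labeled_spaceD[of x \<phi> d] that size by (auto simp: X_def)
  have "(\<lambda>k. p k y) \<longlonglongrightarrow> 1 / card X" if y: "y \<in> X" for y
  proof (rule iterated_kernel_tendsto_uniform[where K = "\<lambda>x. pmf (shuffle_step X x)", OF fin])
    show "(\<Sum>y\<in>X. pmf (shuffle_step X x) y) = 1" if "x \<in> X" for x
      using fin set_pmf_shuffle_step[OF that] by (rule sum_pmf_eq_1)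
    show "pmf (shuffle_step X x) y = pmf (shuffle_step X y) x" if "x \<in> X" "y \<in> X" for x y
      using that sizes by (intro shuffle_step_sym[of d]) auto
    show "0 < pmf (shuffle_step X x) x" if "x \<in> X" for x
      using that sizes by (intro shuffle_step_lazy)
    show "(x, y) \<in> {(x, y). x \<in> X \<and> y \<in> X \<and> 0 < pmf (shuffle_step X x) y}\<^sup>*"
      if "x \<in> X" "y \<in> X" for x y
      using labeled_space_connected[of x \<phi> d y] that unfolding X_def shuffle_edges_def by simp
    show "(\<Sum>x\<in>X. p k x) = 1" for k
      unfolding p_def using fin supp by (rule sum_pmf_eq_1)
    show "p (Suc k) y = (\<Sum>x\<in>X. p k x * pmf (shuffle_step X x) y)" for k y
    proof -
      have "p (Suc k) y = measure_pmf.expectation (shuffling_method X H\<^sub>0 k) (\<lambda>x. pmf (shuffle_step X x) y)"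
        by (simp add: p_def pmf_bind)
      also have "\<dots> = (\<Sum>x\<in>X. pmf (shuffle_step X x) y * p k x)"
        unfolding p_def using supp[of k] by (intro integral_measure_pmf_real fin) auto
      finally show ?thesis by (simp add: mult.commute)
    qed
  qed (use y in auto)
  \<comment> \<open>All distributions live on the finite set \<open>X\<close>, so expectations are
    finite sums and pointwise convergence of \<open>p\<close> suffices.\<close>
  then have lim: "(\<lambda>k. \<Sum>y\<in>X. f y * p k y) \<longlonglongrightarrow> (\<Sum>y\<in>X. f y * (1 / card X))" for f :: "_ \<Rightarrow> real"
    by (intro tendsto_sum tendsto_mult_left) simp
  have "measure_pmf.expectation (shuffling_method X H\<^sub>0 k) f = (\<Sum>y\<in>X. f y * p k y)" for f :: "_ \<Rightarrow> real" and k
    unfolding p_def using supp[of k] by (intro integral_measure_pmf_real fin) auto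
  moreover have "measure_pmf.expectation (pmf_of_set X) f = (\<Sum>y\<in>X. f y * (1 / card X))" for f :: "_ \<Rightarrow> real"
    by (simp add: integral_pmf_of_set[OF ne fin] sum_divide_distrib)
  ultimately show ?thesis
    unfolding converges_in_distribution_def X_def[symmetric] using lim by simp
qed

theorem theorem1:
  fixes d :: "'v degree_seq" and \<H> :: "'v stub_graph set" and H\<^sub>0 :: "'v stub_graph"
  assumes "size (seq_arcs d) \<ge> 2"
    and "\<H> = stub_space {Self_Loops, Degenerate_Hyperarcs, Multi_Hyperarcs} d \<or>
         \<H> = stub_space {Self_Loops, Multi_Hyperarcs} d"
    and "H\<^sub>0 \<in> \<H>"
  shows "converges_in_distribution (\<lambda>k. shuffling_method \<H> H\<^sub>0 k) (pmf_of_set \<H>)"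
  using assms(2)
proof
  assume "\<H> = stub_space {Self_Loops, Degenerate_Hyperarcs, Multi_Hyperarcs} d"
  then have "\<H> = labeled_space id d" by (simp only: stub_space_eq_labeled_space)
  then show ?thesis using labeled_space_converges assms(1,3) by blast
next
  assume "\<H> = stub_space {Self_Loops, Multi_Hyperarcs} d"
  then have "\<H> = labeled_space vertex d" by (simp only: stub_space_nondegenerate_eq_labeled_space)
  then show ?thesis using labeled_space_converges assms(1,3) by blast
qed

end
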